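(* Let $0<\epsilon<1$ be a fixed real number. Let $A>0$ and $B$ be integers with $\gcd(A,B)=1$, $A^2-4B>0$, $|B|<A^{2-\epsilon}$, and such that the polynomial $X^2-AX+B$ is irreducible over $\mathbb{Q}$. Let $V_n=\alpha^n+\beta^n$, where $\alpha,\beta$ are the roots of $X^2-AX+B$. Let $b,c$ be integers with $b\geq 2$ if $c\geq 0$ and $b\geq 3$ if $c<0$. Assume that the equation $$V_n-b^m=c$$ has three solutions $(n_1,m_1),(n_2,m_2),(n_3,m_3)\in\mathbb{N}^2$ with $n_1>n_2>n_3\geq N_0(\epsilon)$, where $N_0(\epsilon)=\frac{3}{2\epsilon}$. Then there exists an effectively computable constant $C_1=C_1(\epsilon,b)$, depending only on $\epsilon$ and $b$, such that $n_1<C_1$ or $A<32^{1/\epsilon}$. In particular, one can choose $$C_1=4.83\cdot 10^{32}\,\frac{(\log b)^4}{\epsilon^2}\left(\log\left[5.56\cdot 10^{36}\,\frac{(\log b)^4}{\epsilon^2}\right]\right)^4.$$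
   Context: $\mathbb{N}$ denotes the nonnegative integers and $\log$ is the natural logarithm. $(V_n)$ is the Lucas-Lehmer sequence of the second kind attached to $(A,B)$; it is an integer sequence. *)

theory Defs
  imports Complex_Main "HOL-Computational_Algebra.Computational_Algebra"
begin

definition lucas_poly :: "int \<Rightarrow> int \<Rightarrow> 'a::comm_ring_1 poly" where
  "lucas_poly A B = [:of_int B, - of_int A, 1:]"

text \<open>The Lucas-Lehmer sequence of the second kind, as a function of the two roots of
  \<^term>\<open>lucas_poly A B\<close>. Its values are integers, but it is typed as real because the roots are.\<close>

definition lucas_V :: "real \<Rightarrow> real \<Rightarrow> nat \<Rightarrow> real" where
  "lucas_V \<alpha> \<beta> n = \<alpha> ^ n + \<beta> ^ n"

definition N0 :: "real \<Rightarrow> real" where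
  "N0 \<epsilon> = 3 / (2 * \<epsilon>)"

definition C1 :: "real \<Rightarrow> int \<Rightarrow> real" where
  "C1 \<epsilon> b = 4.83 * 10 ^ 32 * ((ln (of_int b)) ^ 4 / \<epsilon>\<^sup>2)
     * (ln (5.56 * 10 ^ 36 * ((ln (of_int b)) ^ 4 / \<epsilon>\<^sup>2))) ^ 4"

end

theory Submission
  imports Defs "Jordan_Normal_Form.Determinant" "HOL-Number_Theory.Cong"
begin

text \<open>Only linear forms in two logarithms are needed. Since \<open>\<alpha>\<close> dominates \<open>\<beta>\<close>, the forms
  \<open>n\<^sub>1 log \<alpha> - m\<^sub>1 log b\<close> and \<open>n\<^sub>2 log \<alpha> - m\<^sub>2 log b\<close> are exponentially small in the gaps between consecutive
  solutions, so a lower bound for such forms makes the gaps \<open>O(log b (log n\<^sub>1)\<^sup>2)\<close> (or, for the second form, at least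
  one of the gaps in \<open>n\<close> and in \<open>m\<close>). The differences of consecutive solutions give
  \<open>\<alpha>\<^bsup>n\<^sub>2\<^esup>(\<alpha>\<^bsup>n\<^sub>1-n\<^sub>2\<^esup> - 1) \<approx> b\<^bsup>m\<^sub>2\<^esup>(b\<^bsup>m\<^sub>1-m\<^sub>2\<^esup> - 1)\<close> and \<open>\<alpha>\<^bsup>n\<^sub>3\<^esup>(\<alpha>\<^bsup>n\<^sub>2-n\<^sub>3\<^esup> - 1) \<approx> b\<^bsup>m\<^sub>3\<^esup>(b\<^bsup>m\<^sub>2-m\<^sub>3\<^esup> - 1)\<close>; in their quotient only the
  gaps survive, and the relative error is exponentially small in \<open>\<epsilon> n\<^sub>3 log A\<close>. Liouville's inequality in the ring
  of \<open>\<alpha>\<close> then bounds \<open>n\<^sub>3\<close>, hence \<open>n\<^sub>1\<close>, by the gaps, and no linear form in three logarithms occurs.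

  The bound for two logarithms comes from an integer polynomial \<open>P(x,y)\<close>, found by the pigeonhole
  principle, that is tiny on the curve \<open>y = exp (c x)\<close>. If the linear form is tiny too, Liouville forces \<open>P\<close> to vanish at
  all points \<open>(r m + s n, \<alpha>\<^sup>r b\<^sup>s)\<close> of a box, contradicting a zero estimate.\<close>

section \<open>A zero estimate\<close>

text \<open>For fixed \<open>i\<close> the \<open>L\<close> equations form a linear system with
  nonzero solution \<open>y i ^ l\<close>, so the determinant with entries
  \<open>Q l (z + a j) * u j ^ l\<close> vanishes at \<open>z = x i\<close>. Its degree in
  \<open>z\<close> is at most \<open>D * L\<close>, so it is identically zero. As \<open>z\<close>
  tends to infinity, however, it behaves like a nonzero multiple of the Vandermonde determinant of
  the distinct \<open>u j\<close>. Zero columns are treated in the proof.\<close>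

lemma zero_estimate:
  fixes Q :: "nat \<Rightarrow> real poly" and a u :: "nat \<Rightarrow> real" and x y :: "'i \<Rightarrow> real"
  assumes deg: "\<And>l. l < L \<Longrightarrow> degree (Q l) \<le> D"
    and nz: "l0 < L" "Q l0 \<noteq> 0"
    and u: "inj_on u {..<L}"
    and I: "finite I" "inj_on x I" "D * L < card I"
    and y: "\<And>i. i \<in> I \<Longrightarrow> y i \<noteq> 0"
    and van: "\<And>i j. i \<in> I \<Longrightarrow> j < L \<Longrightarrow> (\<Sum>l<L. poly (Q l) (x i + a j) * (u j * y i) ^ l) = 0"
  shows False
proof -
  \<comment> \<open>A vanishing \<open>Q l\<close> is replaced by \<open>1\<close>, so that the limit of the determinants below is a full
    Vandermonde determinant; the kernel vector gets a \<open>0\<close> at that place instead.\<close>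
  define R where "R l = (if Q l = 0 then 1 else Q l)" for l
  have R0: "R l \<noteq> 0" for l by (simp add: R_def)
  have degR: "degree (R l) \<le> D" if "l < L" for l using deg[OF that] by (simp add: R_def)
  define S where "S j l = R l \<circ>\<^sub>p [:a j, 1:]" for j l
  have degS: "degree (S j l) = degree (R l)" for j l by (simp add: S_def degree_pcompose)
  have lcS: "coeff (S j l) (degree (R l)) = lead_coeff (R l)" for j l
    using lead_coeff_comp[of "[:a j, 1:]" "R l"] degS[of j l] by (simp add: S_def)
  define N where "N = mat L L (\<lambda>(j,l). Polynomial.smult (u j ^ l) (S j l))"
  have N: "N \<in> carrier_mat L L" by (simp add: N_def)
  have degN: "degree (det N) \<le> D * L"
  proof (rule degree_det_le[OF _ N])
    fix i j assume "i < L" "j < L"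
    then show "degree (N $$ (i, j)) \<le> D"
      using degree_smult_le[of "u i ^ j" "S i j"] degS[of i j] degR[of j] by (simp add: N_def)
  qed
  define Ev where "Ev z = mat L L (\<lambda>(j,l). poly (S j l) z * u j ^ l)" for z
  have Ev: "Ev z \<in> carrier_mat L L" for z by (simp add: Ev_def)
  have detEv: "det (Ev z) = poly (det N) z" for z
  proof -
    interpret h: comm_ring_hom "\<lambda>p. poly p z" by unfold_locales auto
    have "map_mat (\<lambda>p. poly p z) N = Ev z" by (rule eq_matI) (auto simp: N_def Ev_def)
    then show ?thesis using h.hom_det[of N] by simp
  qed
  have root: "poly (det N) (x i) = 0" if i: "i \<in> I" for i
  proof -
    define v where "v = vec L (\<lambda>l. if Q l = 0 then 0 else y i ^ l)"
    have v: "v \<in> carrier_vec L" by (simp add: v_def)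
    have "v $ l0 \<noteq> 0" using nz y[OF i] by (simp add: v_def)
    then have v0: "v \<noteq> 0\<^sub>v L" using nz by auto
    have "Ev (x i) *\<^sub>v v = 0\<^sub>v L"
    proof (rule eq_vecI)
      fix j assume "j < dim_vec (0\<^sub>v L :: real vec)"
      then have j: "j < L" by simp
      have "(Ev (x i) *\<^sub>v v) $ j = (\<Sum>l<L. poly (S j l) (x i) * u j ^ l * (v $ l))"
        using j by (simp add: Ev_def scalar_prod_def v_def lessThan_atLeast0)
      also have "\<dots> = (\<Sum>l<L. poly (Q l) (x i + a j) * (u j * y i) ^ l)"
        by (rule sum.cong)
           (auto simp: v_def S_def R_def poly_pcompose power_mult_distrib add.commute)
      finally show "(Ev (x i) *\<^sub>v v) $ j = 0\<^sub>v L $ j" using van[OF i j] j by simp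
    qed (use Ev in auto)
    then have "det (Ev (x i)) = 0" using det_0_iff_vec_prod_zero[OF Ev] v v0 by blast
    then show ?thesis by (simp add: detEv)
  qed
  have det0: "det N = 0"
  proof (rule ccontr)
    assume nz: "det N \<noteq> 0"
    have "card I = card (x ` I)" using I by (simp add: card_image)
    also have "\<dots> \<le> card {z. poly (det N) z = 0}"
      by (rule card_mono) (use root poly_roots_finite[OF nz] in auto)
    also have "\<dots> \<le> degree (det N)" using card_poly_roots_bound[OF nz] by simp
    finally show False using degN I by simp
  qed
  \<comment> \<open>Rescaling the columns by powers of \<open>z\<close> isolates the leading coefficients as \<open>z \<rightarrow> \<infinity>\<close>.\<close>
  define W where "W = mat L L (\<lambda>(j,l). lead_coeff (R l) * u j ^ l)"
  have W: "W \<in> carrier_mat L L" by (simp add: W_def)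
  define F where "F z = mat L L (\<lambda>(j,l). poly (S j l) z / z ^ degree (R l) * u j ^ l)" for z :: real
  have F: "F z \<in> carrier_mat L L" for z by (simp add: F_def)
  have F0: "det (F z) = 0" if z: "z > 0" for z
  proof -
    have "det (Ev z) = 0" by (simp add: detEv det0)
    then obtain v where v: "v \<in> carrier_vec L" "v \<noteq> 0\<^sub>v L" "Ev z *\<^sub>v v = 0\<^sub>v L"
      using det_0_iff_vec_prod_zero[OF Ev] by blast
    define w where "w = vec L (\<lambda>l. v $ l * z ^ degree (R l))"
    have w: "w \<in> carrier_vec L" by (simp add: w_def)
    obtain l where l: "l < L" "v $ l \<noteq> 0" using v by (metis carrier_vecD eq_vecI index_zero_vec)
    then have "w $ l \<noteq> 0" using z by (simp add: w_def)
    then have w0: "w \<noteq> 0\<^sub>v L" using l by auto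
    have "F z *\<^sub>v w = Ev z *\<^sub>v v"
    proof (rule eq_vecI)
      fix j assume "j < dim_vec (Ev z *\<^sub>v v)"
      then have j: "j < L" using Ev[of z] by simp
      have dv: "dim_vec v = L" using v by simp
      have "(F z *\<^sub>v w) $ j = (\<Sum>l<L. poly (S j l) z / z ^ degree (R l) * u j ^ l * (w $ l))"
        using j by (simp add: F_def scalar_prod_def w_def lessThan_atLeast0)
      also have "\<dots> = (\<Sum>l<L. poly (S j l) z * u j ^ l * (v $ l))"
        by (rule sum.cong) (use z in \<open>auto simp: w_def\<close>)
      also have "\<dots> = (Ev z *\<^sub>v v) $ j"
        using j dv by (simp add: Ev_def scalar_prod_def lessThan_atLeast0)
      finally show "(F z *\<^sub>v w) $ j = (Ev z *\<^sub>v v) $ j" .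
    qed (simp_all add: Ev_def F_def)
    then show ?thesis using det_0_iff_vec_prod_zero[OF F] w w0 v by auto
  qed
  have "((\<lambda>z. det (F z)) \<longlongrightarrow> det W) at_top"
    unfolding det_def'[OF W] det_def'[OF F]
  proof (intro tendsto_sum tendsto_mult tendsto_const tendsto_prod)
    fix p i assume p: "p \<in> {p. p permutes {0..<L}}" and i: "i \<in> {0..<L}"
    then have pi: "p i < L" by (metis atLeastLessThan_iff mem_Collect_eq permutes_in_image)
    have "((\<lambda>z. poly (S i (p i)) z / z ^ degree (R (p i))) \<longlongrightarrow> lead_coeff (R (p i))) at_top"
      using tendsto_mono[OF at_top_le_at_infinity poly_divide_tendsto_aux[of "S i (p i)"]]
        lcS[of i "p i"] degS[of i "p i"] by simp
    from tendsto_mult_right[OF this, of "u i ^ p i"]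
    show "((\<lambda>z. F z $$ (i, p i)) \<longlongrightarrow> W $$ (i, p i)) at_top"
      using i pi by (simp add: F_def W_def)
  qed
  moreover have "((\<lambda>z. det (F z)) \<longlongrightarrow> 0) at_top"
    by (rule tendsto_eventually, rule eventually_mono[OF eventually_gt_at_top[of 0]]) (rule F0)
  ultimately have "det W = 0" using tendsto_unique trivial_limit_at_top_linorder by blast
  then obtain w where w: "w \<in> carrier_vec L" "w \<noteq> 0\<^sub>v L" "W *\<^sub>v w = 0\<^sub>v L"
    using det_0_iff_vec_prod_zero[OF W] by blast
  \<comment> \<open>A kernel vector of \<open>W\<close> amounts to a nonzero polynomial of degree
    below \<open>L\<close> with the \<open>L\<close> distinct roots \<open>u j\<close>.\<close>
  define P where "P = (\<Sum>l<L. monom (w $ l * lead_coeff (R l)) l)"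
  have cP: "coeff P l = (if l < L then w $ l * lead_coeff (R l) else 0)" for l
    by (auto simp: P_def coeff_sum)
  obtain l where l: "l < L" "w $ l \<noteq> 0" using w by (metis carrier_vecD eq_vecI index_zero_vec)
  have P0: "P \<noteq> 0"
  proof
    assume "P = 0"
    then show False using cP[of l] l R0[of l] by simp
  qed
  have dP: "degree P < L"
    using l(1) degree_le[of "L - 1" P] cP by (metis (no_types, lifting) One_nat_def Suc_pred
        le_imp_less_Suc less_nat_zero_code linorder_not_less not_less_eq zero_less_iff_neq_zero not_less_iff_gr_or_eq)
  have "poly P (u j) = 0" if j: "j < L" for j
  proof -
    have dw: "dim_vec w = L" using w by simp
    have "poly P (u j) = (\<Sum>l<L. lead_coeff (R l) * u j ^ l * w $ l)"
      by (simp add: P_def poly_sum poly_monom mult_ac)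
    also have "\<dots> = (W *\<^sub>v w) $ j"
      using j dw by (simp add: W_def scalar_prod_def lessThan_atLeast0)
    finally show ?thesis using w j by simp
  qed
  then have "u ` {..<L} \<subseteq> {z. poly P z = 0}" by auto
  then have "card (u ` {..<L}) \<le> card {z. poly P z = 0}"
    by (rule card_mono[rotated]) (rule poly_roots_finite[OF P0])
  also have "\<dots> \<le> degree P" by (rule card_poly_roots_bound[OF P0])
  finally show False using dP u by (simp add: card_image)
qed

section \<open>The auxiliary function\<close>

text \<open>An approximate Siegel lemma. On the box \<open>{0..H}\<close> to the power
  \<open>I\<close>, each form takes values in an interval of length \<open>H ^ 4 * w\<close>, cut
  into cells of width \<open>w\<close>. With four unknowns per form there are more points than
  cells, because \<open>H ^ 4 + 1 < (H + 1) ^ 4\<close>. The saving \<open>H ^ 3\<close> leaves a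
  surplus after the factor \<open>H\<close> that the conjugate costs in Liouville's
  inequality.\<close>

lemma integer_pigeonhole:
  fixes c :: "'i \<Rightarrow> 'j \<Rightarrow> real" and H :: nat and M :: real
  assumes I: "finite I" "I \<noteq> {}" and J: "finite J" "4 * card J \<le> card I" and H: "H \<ge> 1" and M: "M > 0"
    and c: "\<And>i j. i \<in> I \<Longrightarrow> j \<in> J \<Longrightarrow> \<bar>c i j\<bar> \<le> M"
  obtains p :: "'i \<Rightarrow> int" where "\<And>i. i \<in> I \<Longrightarrow> \<bar>p i\<bar> \<le> int H" "\<exists>i\<in>I. p i \<noteq> 0"
    "\<And>j. j \<in> J \<Longrightarrow> \<bar>\<Sum>i\<in>I. of_int (p i) * c i j\<bar> \<le> 2 * card I * M / H ^ 3"
proof -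
  define A where "A = PiE I (\<lambda>_. {0..int H})"
  have "nat (int H + 1) = H + 1" by simp
  then have A: "card A = (H + 1) ^ card I" "finite A"
    using I by (auto simp: A_def card_PiE finite_PiE)
  define w where "w = 2 * card I * M / H ^ 3"
  have N: "card I > 0" using I by (simp add: card_gt_0_iff)
  have w: "w > 0" using H M N by (simp add: w_def)
  define V where "V p j = (\<Sum>i\<in>I. of_int (p i) * c i j)" for p :: "'i \<Rightarrow> int" and j
  define B where "B = real (card I) * H * M"
  have wB: "2 * B = real (H ^ 4) * w" using H by (simp add: B_def w_def field_simps power_numeral_reduce)
  have VB: "\<bar>V p j\<bar> \<le> B" if "p \<in> A" "j \<in> J" for p j
  proof -
    have "\<bar>V p j\<bar> \<le> (\<Sum>i\<in>I. \<bar>of_int (p i) * c i j\<bar>)" unfolding V_def by (rule sum_abs)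
    also have "\<dots> \<le> (\<Sum>i\<in>I. real H * M)"
    proof (rule sum_mono)
      fix i assume i: "i \<in> I"
      have "p i \<in> {0..int H}" using that i by (auto simp: A_def)
      then have "\<bar>real_of_int (p i)\<bar> \<le> H" by auto
      then show "\<bar>of_int (p i) * c i j\<bar> \<le> real H * M"
        unfolding abs_mult using c[OF i that(2)] by (intro mult_mono) auto
    qed
    finally show ?thesis by (simp add: B_def)
  qed
  define \<Phi> where "\<Phi> p = restrict (\<lambda>j. \<lfloor>(V p j + B) / w\<rfloor>) J" for p
  have sub: "\<Phi> ` A \<subseteq> PiE J (\<lambda>_. {0..int (H ^ 4)})"
  proof (intro image_subsetI PiE_I)
    fix p j assume p: "p \<in> A" and j: "j \<in> J"
    have V: "0 \<le> V p j + B" "V p j + B \<le> 2 * B" using VB[OF p j] by linarith+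
    have "0 \<le> (V p j + B) / w" using V w by simp
    moreover have "(V p j + B) / w \<le> real (H ^ 4)" using V w wB by (simp add: pos_divide_le_eq)
    ultimately have "0 \<le> \<lfloor>(V p j + B) / w\<rfloor>" "\<lfloor>(V p j + B) / w\<rfloor> \<le> int (H ^ 4)"
      by (simp, metis floor_mono floor_of_nat)
    then show "\<Phi> p j \<in> {0..int (H ^ 4)}" using j by (simp add: \<Phi>_def)
  qed (simp add: \<Phi>_def)
  have "card (\<Phi> ` A) \<le> card (PiE J (\<lambda>_. {0..int (H ^ 4)}))"
    by (rule card_mono[OF _ sub]) (simp add: J finite_PiE)
  also have "\<dots> = (H ^ 4 + 1) ^ card J"
    using J by (simp add: card_PiE nat_add_distrib nat_power_eq)
  also have "\<dots> < (H + 1) ^ card I"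
  proof (cases "card J = 0")
    case True
    have "(1::nat) < (H + 1) ^ card I" using H N by (intro one_less_power) auto
    then show ?thesis using True by simp
  next
    case False
    have "H ^ 4 + 1 < (H + 1) ^ 4"
      using H by (simp add: eval_nat_numeral algebra_simps)
    then have "(H ^ 4 + 1) ^ card J < ((H + 1) ^ 4) ^ card J"
      using False by (intro power_strict_mono) auto
    also have "\<dots> = (H + 1) ^ (4 * card J)" by (simp add: power_mult)
    also have "\<dots> \<le> (H + 1) ^ card I" using J by (intro power_increasing) auto
    finally show ?thesis .
  qed
  finally have "card (\<Phi> ` A) < card A" using A by simp
  then have "\<not> inj_on \<Phi> A" using pigeonhole by blast
  then obtain p q where pq: "p \<in> A" "q \<in> A" "p \<noteq> q" "\<Phi> p = \<Phi> q" by (auto simp: inj_on_def)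
  show ?thesis
  proof (rule that[of "\<lambda>i. p i - q i"])
    show "\<bar>p i - q i\<bar> \<le> int H" if "i \<in> I" for i
    proof -
      have "p i \<in> {0..int H}" "q i \<in> {0..int H}" using that pq by (auto simp: A_def)
      then show ?thesis by auto
    qed
    show "\<exists>i\<in>I. p i - q i \<noteq> 0"
    proof (rule ccontr)
      assume "\<not> ?thesis"
      then have "p = q" using pq(1,2) unfolding A_def by (intro PiE_ext) auto
      then show False using pq by simp
    qed
    fix j assume j: "j \<in> J"
    have "\<lfloor>(V p j + B) / w\<rfloor> = \<lfloor>(V q j + B) / w\<rfloor>"
      using fun_cong[OF pq(4), of j] j by (simp add: \<Phi>_def)
    then have "\<bar>(V p j + B) / w - (V q j + B) / w\<bar> < 1" by linarith
    also have "(V p j + B) / w - (V q j + B) / w = (V p j - V q j) / w"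
      by (simp add: diff_divide_distrib add_divide_distrib)
    finally have "\<bar>V p j - V q j\<bar> < w" using w by (simp add: pos_divide_less_eq)
    then show "\<bar>\<Sum>i\<in>I. of_int (p i - q i) * c i j\<bar> \<le> 2 * card I * M / H ^ 3"
      by (simp add: V_def w_def algebra_simps sum_subtractf)
  qed
qed

section \<open>The length of a polynomial\<close>

text \<open>The sum of the absolute values of the coefficients. Evaluation at 1 gives the recursion
  along \<open>pCons\<close> on which the inductions below run.\<close>

definition l1_norm :: "real poly \<Rightarrow> real" where
  "l1_norm p = poly (map_poly abs p) 1"

lemma l1_norm_0 [simp]: "l1_norm 0 = 0"
  by (simp add: l1_norm_def)

lemma l1_norm_pCons [simp]: "l1_norm (pCons a p) = \<bar>a\<bar> + l1_norm p"
  by (simp add: l1_norm_def map_poly_pCons)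

lemma l1_norm_nonneg [simp]: "0 \<le> l1_norm p"
  by (induction p) auto

lemma l1_norm_add: "l1_norm (p + q) \<le> l1_norm p + l1_norm q"
proof (induction p q rule: poly_induct2)
  case (pCons a p b q)
  then show ?case using abs_triangle_ineq[of a b] by simp
qed simp

lemma l1_norm_smult [simp]: "l1_norm (Polynomial.smult a p) = \<bar>a\<bar> * l1_norm p"
  by (induction p) (auto simp: abs_mult algebra_simps)

lemma l1_norm_mult: "l1_norm (p * q) \<le> l1_norm p * l1_norm q"
proof (induction p)
  case (pCons a p)
  have "l1_norm (pCons a p * q) \<le> l1_norm (Polynomial.smult a q) + l1_norm (pCons 0 (p * q))"
    by (simp only: mult_pCons_left l1_norm_add)
  then show ?case using pCons by (simp add: algebra_simps)
qed simp

lemma l1_norm_sum: "l1_norm (sum f A) \<le> (\<Sum>i\<in>A. l1_norm (f i))"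
proof (induction A rule: infinite_finite_induct)
  case (insert x F)
  then show ?case using l1_norm_add[of "f x" "sum f F"] by simp
qed auto

lemma l1_norm_monom [simp]: "l1_norm (monom a n) = \<bar>a\<bar>"
  by (induction n) (auto simp: monom_Suc monom_0)

lemma abs_coeff_le_l1_norm: "\<bar>coeff p n\<bar> \<le> l1_norm p"
proof (induction p arbitrary: n)
  case (pCons a p)
  show ?case
    by (cases n) (use pCons.IH in \<open>auto intro: order_trans simp: add_increasing\<close>)
qed simp

section \<open>Taylor polynomials of the exponential and binomial polynomials\<close>

lemma power_div_fact_le_exp: "x ^ k / fact k \<le> exp x" if "x \<ge> 0" for x :: real
proof -
  have "(\<Sum>i\<in>{k}. x ^ i /\<^sub>R fact i) \<le> (\<Sum>i. x ^ i /\<^sub>R fact i)"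
    by (rule sum_le_suminf) (use that summable_exp_generic[of x] in auto)
  then show ?thesis by (simp add: exp_def divide_inverse mult.commute)
qed

lemma exp_taylor_le_exp: "(\<Sum>i<n. x ^ i / fact i) \<le> exp x" if "x \<ge> 0" for x :: real
proof -
  have "(\<Sum>i<n. x ^ i /\<^sub>R fact i) \<le> (\<Sum>i. x ^ i /\<^sub>R fact i)"
    by (rule sum_le_suminf) (use that summable_exp_generic[of x] in auto)
  then show ?thesis by (simp add: exp_def divide_inverse mult.commute)
qed

text \<open>The Lagrange remainder is at most \<open>exp e * e ^ N / fact N\<close>, and
  \<open>N ^ N \<le> exp N * fact N\<close> turns \<open>exp 2 * e \<le> N\<close> into
  \<open>e ^ N / fact N \<le> exp (- N)\<close>.\<close>

lemma exp_taylor_error: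
  fixes t e :: real
  assumes t: "0 \<le> t" "t \<le> e" and N: "exp 2 * e \<le> real N"
  shows "\<bar>exp t - (\<Sum>i<N. t ^ i / fact i)\<bar> \<le> exp e * exp (- real N)"
proof -
  obtain \<theta> where \<theta>: "\<bar>\<theta>\<bar> \<le> \<bar>t\<bar>" "exp t = (\<Sum>m<N. t ^ m / fact m) + exp \<theta> / fact N * t ^ N"
    using Maclaurin_exp_le[of t N] by blast
  have e0: "0 \<le> e" using t by simp
  have "exp 2 ^ N * e ^ N \<le> real N ^ N"
    unfolding power_mult_distrib[symmetric] using N e0 by (intro power_mono) auto
  also have "\<dots> \<le> exp (real N) * fact N"
    using power_div_fact_le_exp[of "real N" N] by (simp add: divide_simps)
  finally have "exp 2 ^ N * e ^ N \<le> exp (real N) * fact N" .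
  moreover have "exp 2 ^ N = exp (real N) * exp (real N)"
    by (simp add: exp_of_nat_mult[symmetric] exp_add[symmetric])
  ultimately have "exp (real N) * (exp (real N) * e ^ N) \<le> exp (real N) * fact N" by (simp add: mult_ac)
  then have "exp (real N) * e ^ N \<le> fact N" by (simp only: mult_le_cancel_left_pos exp_gt_zero)
  then have "e ^ N / fact N \<le> exp (- real N)" by (simp add: exp_minus field_simps)
  moreover have "t ^ N \<le> e ^ N" using t by (intro power_mono) auto
  ultimately have "t ^ N / fact N \<le> exp (- real N)"
    by (smt (verit) divide_right_mono fact_ge_zero)
  moreover have "exp \<theta> \<le> exp e" using \<theta> t by simp
  ultimately have "exp \<theta> * (t ^ N / fact N) \<le> exp e * exp (- real N)"
    using t by (intro mult_mono) auto
  moreover have "0 \<le> exp \<theta> * (t ^ N / fact N)" using t by simp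
  ultimately show ?thesis using \<theta>(2) by simp
qed

lemma abs_poly_le_l1_norm: "\<bar>poly p t\<bar> \<le> l1_norm p" if "\<bar>t\<bar> \<le> 1"
proof (induction p)
  case (pCons a p)
  have "\<bar>t * poly p t\<bar> \<le> 1 * l1_norm p" unfolding abs_mult using that pCons by (intro mult_mono) auto
  then show ?case by simp
qed simp

text \<open>The binomial coefficient of \<open>X * t\<close> over \<open>k\<close> as a polynomial
  in \<open>t\<close>. The scaling carries \<open>[0, X]\<close> to \<open>[0, 1]\<close>, where the
  length bounds the values.\<close>

definition binom_poly :: "real \<Rightarrow> nat \<Rightarrow> real poly" where
  "binom_poly X k = Polynomial.smult (1 / fact k) (\<Prod>i<k. [:- real i, X:])"

lemma poly_binom_poly: "poly (binom_poly X k) t = (X * t) gchoose k"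
  by (simp add: binom_poly_def poly_prod gbinomial_prod_rev lessThan_atLeast0 algebra_simps)

lemma degree_binom_poly: "degree (binom_poly X k) \<le> k"
proof -
  have "degree (\<Prod>i<k. [:- real i, X:]) \<le> (\<Sum>i<k. degree [:- real i, X:])"
    using degree_prod_sum_le[OF finite_lessThan, of "\<lambda>i. [:- real i, X:]" k] by (simp only: comp_def)
  also have "\<dots> \<le> (\<Sum>i<k. 1)" by (intro sum_mono) simp
  finally show ?thesis unfolding binom_poly_def using degree_smult_le order_trans by fastforce
qed

text \<open>Each linear factor has length at most \<open>w * K\<close>, and
  \<open>K ^ k / fact k \<le> exp K\<close> disposes of the powers of \<open>K\<close>. The bound
  thus depends on the ratio of \<open>X\<close> to \<open>K\<close> only, whereas powers of
  \<open>X * t\<close> would cost \<open>X ^ K\<close>.\<close>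

lemma l1_norm_binom_poly:
  assumes X: "X \<ge> 0" and k: "k \<le> K" and w: "w \<ge> 1" "X + real K \<le> w * real K"
  shows "l1_norm (binom_poly X k) \<le> (exp 1 * w) ^ K"
proof -
  have "l1_norm (\<Prod>i<j. [:- real i, X:]) \<le> (w * real K) ^ j" if "j \<le> K" for j
    using that
  proof (induction j)
    case (Suc j)
    have "l1_norm (\<Prod>i<Suc j. [:- real i, X:]) \<le> l1_norm (\<Prod>i<j. [:- real i, X:]) * l1_norm [:- real j, X:]"
      by (simp only: prod.lessThan_Suc l1_norm_mult)
    also have "\<dots> \<le> (w * real K) ^ j * (w * real K)"
    proof (rule mult_mono)
      show "l1_norm [:- real j, X:] \<le> w * real K" using w Suc.prems X by (simp flip: of_nat_Suc)
    qed (use Suc w in auto)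
    finally show ?case by (simp add: mult_ac)
  qed (simp add: one_pCons)
  from this[OF k] have "l1_norm (binom_poly X k) \<le> (w * real K) ^ k / fact k"
    by (simp add: binom_poly_def divide_simps)
  also have "\<dots> = w ^ k * (real K ^ k / fact k)" by (simp add: power_mult_distrib)
  also have "\<dots> \<le> w ^ K * exp (real K)"
    using power_div_fact_le_exp[of "real K" k] w k by (intro mult_mono power_increasing) auto
  also have "\<dots> = (exp 1 * w) ^ K" by (simp add: power_mult_distrib exp_of_nat_mult[symmetric])
  finally show ?thesis .
qed

definition exp_poly :: "real \<Rightarrow> nat \<Rightarrow> real poly" where
  "exp_poly s N = (\<Sum>i<N. Polynomial.monom (s ^ i / fact i) i)"

lemma poly_exp_poly: "poly (exp_poly s N) t = (\<Sum>i<N. (s * t) ^ i / fact i)"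
  by (simp add: exp_poly_def poly_sum poly_monom power_mult_distrib)

lemma coeff_exp_poly: "n \<ge> N \<Longrightarrow> coeff (exp_poly s N) n = 0"
  by (auto simp: exp_poly_def coeff_sum)

lemma l1_norm_exp_poly: "l1_norm (exp_poly s N) \<le> exp s" if "s \<ge> 0"
proof -
  have "l1_norm (exp_poly s N) \<le> (\<Sum>i<N. s ^ i / fact i)"
    unfolding exp_poly_def using that by (intro order_trans[OF l1_norm_sum]) simp
  then show ?thesis using exp_taylor_le_exp[OF that, of N] by simp
qed

text \<open>The Taylor coefficients up to order \<open>K + K L'\<close> are made small by the pigeonhole principle, and the
  others are small because \<open>K L'\<close> exceeds \<open>e\<^sup>2 E\<close>. Thus no vanishing at points has to be imposed and
  no Schwarz lemma is needed.\<close>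

lemma auxiliary_function:
  fixes K L L' H :: nat and X c w E M :: real
  assumes K: "K \<ge> 1" and L: "L = 8 * L'" "L' \<ge> 1" and X: "X > 0" and c: "c \<ge> 0"
    and w: "w \<ge> 1" "X + real K \<le> w * real K" and E: "real L * c * X \<le> E" "exp 2 * E \<le> real (K * L')"
    and M: "M = (exp 1 * w) ^ K * exp E" and H: "H \<ge> 1"
  obtains p :: "nat \<times> nat \<Rightarrow> int" where
    "\<And>i. i \<in> {..<K} \<times> {..<L} \<Longrightarrow> \<bar>p i\<bar> \<le> int H" "\<exists>i\<in>{..<K} \<times> {..<L}. p i \<noteq> 0"
    "\<And>z. 0 \<le> z \<Longrightarrow> z \<le> X \<Longrightarrow> \<bar>\<Sum>(k,l)\<in>{..<K} \<times> {..<L}. of_int (p (k,l)) * (z gchoose k) * exp (real l * c * z)\<bar>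
      \<le> 2 * real (K * L) ^ 2 * M / H ^ 3 + real (K * L) * H * M * exp (- real (K * L'))"
proof -
  define I where "I = {..<K} \<times> {..<L}"
  define N where "N = K * L'"
  define U where "U = K * L"
  have cardI: "card I = U" by (simp add: I_def U_def)
  have fin: "finite I" by (simp add: I_def)
  have Iex: "I \<noteq> {}" using K L by (auto simp: I_def lessThan_empty_iff)
  have wK: "(exp 1 * w) ^ K > 0" using w by simp
  have M0: "M > 0" using wK by (simp add: M)
  \<comment> \<open>With \<open>t = z / X\<close> this is the product of the binomial coefficient
    and the exponential series cut after \<open>N\<close> terms, a polynomial on
    \<open>[0, 1]\<close>.\<close>
  define G where "G kl = binom_poly X (fst kl) * exp_poly (real (snd kl) * c * X) N" for kl
  have E1: "0 \<le> real l * c * X" "real l * c * X \<le> E" if "l < L" for l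
  proof -
    show "0 \<le> real l * c * X" using X c by simp
    have "real l * c * X \<le> real L * c * X" using that X c by (intro mult_right_mono) auto
    then show "real l * c * X \<le> E" using E by simp
  qed
  have bp: "l1_norm (binom_poly X k) \<le> (exp 1 * w) ^ K" if "k < K" for k
    using l1_norm_binom_poly[of X k K w] X w that by simp
  have G: "l1_norm (G i) \<le> M" if i: "i \<in> I" for i
  proof -
    obtain k l where kl: "i = (k,l)" "k < K" "l < L" using i by (auto simp: I_def)
    have "l1_norm (exp_poly (real l * c * X) N) \<le> exp E"
      using l1_norm_exp_poly[of "real l * c * X" N] E1[OF kl(3)] by (meson exp_le_cancel_iff order_trans)
    then have "l1_norm (binom_poly X k) * l1_norm (exp_poly (real l * c * X) N) \<le> M"
      unfolding M using bp[OF kl(2)] wK by (intro mult_mono) auto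
    then show ?thesis unfolding G_def kl using l1_norm_mult order_trans by fastforce
  qed
  have degG: "degree (G i) < K + N" if i: "i \<in> I" for i
  proof -
    obtain k l where kl: "i = (k,l)" "k < K" "l < L" using i by (auto simp: I_def)
    have "degree (exp_poly (real l * c * X) N) \<le> N"
      by (rule degree_le) (simp add: coeff_exp_poly)
    then show ?thesis unfolding G_def kl using degree_mult_le[of "binom_poly X k" "exp_poly (real l * c * X) N"]
        degree_binom_poly[of X k] kl by simp
  qed
  \<comment> \<open>The reason for \<open>L = 8 * L'\<close>: the \<open>K + N\<close> coefficients
    number at most \<open>2 * K * L'\<close>, a quarter of the \<open>K * L\<close>
    unknowns.\<close>
  have card4: "4 * card {..<K + N} \<le> card I" unfolding cardI using L K by (simp add: U_def N_def)
  obtain p where p: "\<And>i. i \<in> I \<Longrightarrow> \<bar>p i\<bar> \<le> int H" "\<exists>i\<in>I. p i \<noteq> 0"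
    "\<And>j. j \<in> {..<K + N} \<Longrightarrow> \<bar>\<Sum>i\<in>I. of_int (p i) * coeff (G i) j\<bar> \<le> 2 * card I * M / H ^ 3"
  proof (rule integer_pigeonhole[OF fin Iex finite_lessThan card4 H M0, of "\<lambda>i j. coeff (G i) j"])
    show "\<bar>coeff (G i) j\<bar> \<le> M" if "i \<in> I" for i j
      using abs_coeff_le_l1_norm[of "G i" j] G[OF that] by linarith
  qed blast
  show ?thesis
  proof (rule that[of p])
    fix z assume z: "0 \<le> z" "z \<le> X"
    define t where "t = z / X"
    have t: "0 \<le> t" "t \<le> 1" "X * t = z" using z X by (auto simp: t_def)
    have A: "\<bar>\<Sum>i\<in>I. of_int (p i) * poly (G i) t\<bar> \<le> 2 * real U ^ 2 * M / H ^ 3"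
    proof -
      have "poly (G i) t = (\<Sum>j<K+N. coeff (G i) j * t ^ j)" if "i \<in> I" for i
      proof -
        have "poly (G i) t = (\<Sum>j\<le>degree (G i). coeff (G i) j * t ^ j)" by (rule poly_altdef)
        also have "\<dots> = (\<Sum>j<K+N. coeff (G i) j * t ^ j)"
          by (rule sum.mono_neutral_left) (use degG[OF that] in \<open>auto simp: coeff_eq_0\<close>)
        finally show ?thesis .
      qed
      then have "(\<Sum>i\<in>I. of_int (p i) * poly (G i) t) = (\<Sum>i\<in>I. \<Sum>j<K+N. of_int (p i) * coeff (G i) j * t ^ j)"
        by (simp add: sum_distrib_left mult.assoc)
      also have "\<dots> = (\<Sum>j<K+N. (\<Sum>i\<in>I. of_int (p i) * coeff (G i) j) * t ^ j)"
        by (subst sum.swap) (simp add: sum_distrib_right)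
      finally have "\<bar>\<Sum>i\<in>I. of_int (p i) * poly (G i) t\<bar> \<le> (\<Sum>j<K+N. \<bar>(\<Sum>i\<in>I. of_int (p i) * coeff (G i) j) * t ^ j\<bar>)"
        by simp
      also have "\<dots> \<le> (\<Sum>j<K+N. 2 * card I * M / H ^ 3)"
      proof (rule sum_mono)
        fix j assume j: "j \<in> {..<K+N}"
        have "\<bar>(\<Sum>i\<in>I. of_int (p i) * coeff (G i) j)\<bar> * \<bar>t ^ j\<bar> \<le> (2 * card I * M / H ^ 3) * 1"
          using p(3)[OF j] t M0 by (intro mult_mono) (auto simp: power_abs power_le_one)
        then show "\<bar>(\<Sum>i\<in>I. of_int (p i) * coeff (G i) j) * t ^ j\<bar> \<le> 2 * card I * M / H ^ 3"
          by (simp add: abs_mult)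
      qed
      also have "\<dots> = real (K + N) * (2 * U * M / H ^ 3)" by (simp add: cardI)
      also have "\<dots> \<le> real U * (2 * U * M / H ^ 3)"
        using card4 M0 by (intro mult_right_mono) (auto simp: cardI)
      finally show ?thesis by (simp add: power2_eq_square mult_ac)
    qed
    define f where "f i = (z gchoose fst i) * exp (real (snd i) * c * z)" for i :: "nat \<times> nat"
    \<comment> \<open>The cost of cutting the series: the Taylor remainder of order \<open>N\<close>
      times the bound for the binomial coefficient.\<close>
    have B: "\<bar>of_int (p i) * (f i - poly (G i) t)\<bar> \<le> H * (M * exp (- real N))" if i: "i \<in> I" for i
    proof -
      obtain k l where kl: "i = (k,l)" "k < K" "l < L" using i by (auto simp: I_def)
      have lcz: "real l * c * X * t = real l * c * z" using t by (simp add: mult_ac)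
      have lz: "0 \<le> real l * c * z" "real l * c * z \<le> E"
        using E1[OF kl(3)] lcz t mult_left_le[of t "real l * c * X"] c z by auto
      have "f i - poly (G i) t = (z gchoose k) * (exp (real l * c * z) - (\<Sum>j<N. (real l * c * z) ^ j / fact j))"
        by (simp add: f_def G_def kl poly_binom_poly poly_exp_poly t(3) lcz right_diff_distrib)
      also have "\<bar>\<dots>\<bar> \<le> (exp 1 * w) ^ K * (exp E * exp (- real N))"
        unfolding abs_mult
      proof (rule mult_mono)
        show "\<bar>z gchoose k\<bar> \<le> (exp 1 * w) ^ K"
          using abs_poly_le_l1_norm[of t "binom_poly X k"] bp[OF kl(2)] t by (simp add: poly_binom_poly)
        show "\<bar>exp (real l * c * z) - (\<Sum>j<N. (real l * c * z) ^ j / fact j)\<bar> \<le> exp E * exp (- real N)"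
          by (rule exp_taylor_error) (use lz E in \<open>auto simp: N_def\<close>)
      qed (use wK in auto)
      also have "\<dots> = M * exp (- real N)" by (simp add: M)
      finally have "\<bar>f i - poly (G i) t\<bar> \<le> M * exp (- real N)" .
      moreover have "\<bar>real_of_int (p i)\<bar> \<le> H" using p(1)[OF i] by linarith
      ultimately show ?thesis unfolding abs_mult using M0 by (intro mult_mono) auto
    qed
    have "\<bar>\<Sum>i\<in>I. of_int (p i) * (f i - poly (G i) t)\<bar> \<le> (\<Sum>i\<in>I. H * (M * exp (- real N)))"
      by (rule order_trans[OF sum_abs sum_mono]) (rule B)
    then have "\<bar>(\<Sum>i\<in>I. of_int (p i) * f i) - (\<Sum>i\<in>I. of_int (p i) * poly (G i) t)\<bar> \<le> U * H * M * exp (- real N)"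
      by (simp add: right_diff_distrib sum_subtractf cardI mult_ac)
    then have "\<bar>\<Sum>i\<in>I. of_int (p i) * f i\<bar> \<le> 2 * real U ^ 2 * M / H ^ 3 + U * H * M * exp (- real N)"
      using A by linarith
    also have "(\<Sum>i\<in>I. of_int (p i) * f i) = (\<Sum>(k,l)\<in>I. of_int (p (k,l)) * (z gchoose k) * exp (real l * c * z))"
      by (rule sum.cong) (auto simp: f_def)
    finally show "\<bar>\<Sum>(k,l)\<in>{..<K} \<times> {..<L}. of_int (p (k,l)) * (z gchoose k) * exp (real l * c * z)\<bar>
      \<le> 2 * real (K * L) ^ 2 * M / H ^ 3 + real (K * L) * H * M * exp (- real (K * L'))"
      unfolding I_def U_def N_def by simp
  qed (use p in \<open>auto simp: I_def\<close>)
qed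

lemma abs_exp_minus_1_le: "\<bar>exp x - 1\<bar> \<le> 2 * \<bar>x\<bar>" if "\<bar>x\<bar> \<le> 1" for x :: real
proof (cases "x \<ge> 0")
  case True
  then have "exp x \<le> 1 + x + x\<^sup>2" using that by (intro exp_bound) auto
  moreover have "x\<^sup>2 \<le> x" using True that by (simp add: power2_eq_square mult_left_le)
  moreover have "exp x \<ge> 1" using True by simp
  ultimately show ?thesis using True by simp
next
  case False
  then have "exp x \<le> 1" by simp
  then show ?thesis using exp_ge_add_one_self[of x] False by linarith
qed

section \<open>Conjugate pairs\<close>

locale quad_pair =
  fixes \<alpha> \<beta> :: real and A B :: int
  assumes sum_eq: "\<alpha> + \<beta> = of_int A" and prod_eq: "\<alpha> * \<beta> = of_int B" and irrational: "\<alpha> \<notin> \<rat>"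
begin

text \<open>The two real embeddings of one element of \<open>\<int>[X]/(X\<^sup>2 - A X + B)\<close>.\<close>

definition conj_pair :: "real \<Rightarrow> real \<Rightarrow> bool" where
  "conj_pair x y \<longleftrightarrow> (\<exists>g h :: int. x = of_int g + of_int h * \<alpha> \<and> y = of_int g + of_int h * \<beta>)"

lemma conj_pairI: "x = of_int g + of_int h * \<alpha> \<Longrightarrow> y = of_int g + of_int h * \<beta> \<Longrightarrow> conj_pair x y"
  by (auto simp: conj_pair_def)

lemma conj_pair_of_int [intro]: "conj_pair (of_int k) (of_int k)"
  by (rule conj_pairI[of _ k 0]) auto

lemma conj_pair_1 [intro]: "conj_pair 1 1"
  using conj_pair_of_int[of 1] by simp

lemma conj_pair_root [intro]: "conj_pair \<alpha> \<beta>"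
  by (rule conj_pairI[of _ 0 1]) auto

lemma conj_pair_add [intro]:
  assumes "conj_pair x y" "conj_pair x' y'" shows "conj_pair (x + x') (y + y')"
proof -
  obtain g h g' h' where e: "x = of_int g + of_int h * \<alpha>" "y = of_int g + of_int h * \<beta>"
    "x' = of_int g' + of_int h' * \<alpha>" "y' = of_int g' + of_int h' * \<beta>"
    using assms unfolding conj_pair_def by blast
  show ?thesis by (rule conj_pairI[of _ "g + g'" "h + h'"]) (auto simp: e algebra_simps)
qed

lemma conj_pair_mult [intro]:
  assumes "conj_pair x y" "conj_pair x' y'" shows "conj_pair (x * x') (y * y')"
proof -
  obtain g h g' h' where e: "x = of_int g + of_int h * \<alpha>" "y = of_int g + of_int h * \<beta>"
    "x' = of_int g' + of_int h' * \<alpha>" "y' = of_int g' + of_int h' * \<beta>"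
    using assms unfolding conj_pair_def by blast
  have sq: "z * z = of_int A * z - of_int B" if "z = \<alpha> \<or> z = \<beta>" for z
    using that by (auto simp flip: sum_eq prod_eq simp: algebra_simps)
  have "(of_int g + of_int h * z) * (of_int g' + of_int h' * z)
    = of_int (g * g' - h * h' * B) + of_int (g * h' + g' * h + h * h' * A) * z" if "z = \<alpha> \<or> z = \<beta>" for z
  proof -
    have "(of_int g + of_int h * z) * (of_int g' + of_int h' * z)
      = of_int (g * g') + of_int (g * h' + g' * h) * z + of_int (h * h') * (z * z)" by (simp add: algebra_simps)
    then show ?thesis unfolding sq[OF that] by (simp add: algebra_simps)
  qed
  then show ?thesis
    by (intro conj_pairI[of _ "g * g' - h * h' * B" "g * h' + g' * h + h * h' * A"]) (auto simp: e)
qed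

lemma conj_pair_diff [intro]:
  assumes "conj_pair x y" "conj_pair x' y'" shows "conj_pair (x - x') (y - y')"
  using conj_pair_add[OF assms(1) conj_pair_mult[OF conj_pair_of_int[of "-1"] assms(2)]] by simp

lemma conj_pair_power [intro]: "conj_pair x y \<Longrightarrow> conj_pair (x ^ n) (y ^ n)"
  by (induction n) auto

lemma conj_pair_sum:
  "(\<And>i. i \<in> S \<Longrightarrow> conj_pair (f i) (g i)) \<Longrightarrow> conj_pair (sum f S) (sum g S)"
proof (induction S rule: infinite_finite_induct)
  case (insert x F) then show ?case by auto
qed (use conj_pair_of_int[of 0] in auto)

lemma irrational_conj: "\<beta> \<notin> \<rat>"
proof
  assume "\<beta> \<in> \<rat>"
  then have "of_int A - \<beta> \<in> \<rat>" by simp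
  then show False using irrational sum_eq by (metis add_diff_cancel_right')
qed

lemma int_lin_eq_0:
  assumes "(z :: real) \<notin> \<rat>" "of_int g + of_int h * z = 0" shows "g = 0 \<and> h = 0"
proof (cases "h = 0")
  case False
  have "of_int h * z = - of_int g" using assms(2) by linarith
  then have "z = - of_int g / of_int h" using False by (simp add: field_simps)
  then have "z \<in> \<rat>" by simp
  then show ?thesis using assms(1) by simp
qed (use assms in simp)

lemma conj_pair_eq_0_iff: "conj_pair x y \<Longrightarrow> x = 0 \<longleftrightarrow> y = 0"
  unfolding conj_pair_def using int_lin_eq_0[OF irrational] int_lin_eq_0[OF irrational_conj]
  by (metis add.right_neutral mult_zero_left of_int_0)

text \<open>Liouville's inequality: the product of the two embeddings is the norm, an integer, and
  it is nonzero because \<open>\<alpha>\<close> and \<open>\<beta>\<close> are irrational.\<close>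

lemma conj_pair_norm_ge_1:
  assumes "conj_pair x y" "x \<noteq> 0" shows "1 \<le> \<bar>x\<bar> * \<bar>y\<bar>"
proof -
  obtain g h where e: "x = of_int g + of_int h * \<alpha>" "y = of_int g + of_int h * \<beta>"
    using assms unfolding conj_pair_def by blast
  have "x * y = of_int g * of_int g + of_int g * of_int h * (\<alpha> + \<beta>) + of_int h * of_int h * (\<alpha> * \<beta>)"
    by (simp add: e algebra_simps)
  also have "\<dots> = of_int (g * g + g * h * A + h * h * B)" by (simp add: sum_eq prod_eq)
  finally have xy: "x * y = of_int (g * g + g * h * A + h * h * B)" .
  have "x * y \<noteq> 0" using assms conj_pair_eq_0_iff by auto
  then have "g * g + g * h * A + h * h * B \<noteq> 0" unfolding xy of_int_eq_0_iff .
  then have "1 \<le> \<bar>g * g + g * h * A + h * h * B\<bar>" by linarith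
  then show ?thesis unfolding abs_mult[symmetric] xy by linarith
qed

end

section \<open>Linear forms in two logarithms\<close>

lemma ln_ge_half: "1 / 2 \<le> ln x" if "2 \<le> x" for x :: real
proof -
  have "exp (1/2) * exp (1/2) = exp (1::real)" by (simp flip: exp_add)
  then have "exp (1/2) ^ 2 \<le> (2::real) ^ 2" using exp_le by (simp add: power2_eq_square)
  then have "exp (1/2) \<le> (2::real)" by (rule power2_le_imp_le) simp
  then have "exp (1/2) \<le> x" using that by linarith
  then show ?thesis using that by (subst ln_ge_iff) linarith+
qed

text \<open>The three summands come from the pigeonhole principle, the cut Taylor series and the
  linear form; the factor \<open>U * H * M\<close> in front bounds the conjugate. For
  \<open>H\<close> of size \<open>3 * U ^ 2 * M\<close> the contributions are at most 2/9, at most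
  1/3 and less than 1/3.\<close>

lemma two_logs_size:
  fixes U H M L e lam :: real
  assumes U: "1 \<le> U" "1 \<le> L" "L \<le> U" and M: "1 \<le> M" and H: "3 * U ^ 2 * M \<le> H" "H \<le> 4 * U ^ 2 * M"
    and e: "0 < e" "48 * U ^ 6 * M ^ 4 * e \<le> 1" and lam: "0 \<le> lam" "192 * U ^ 7 * M ^ 4 * lam < 1"
  shows "(U * H * M) * (2 * U ^ 2 * M / H ^ 3 + U * H * M * e + U * H * M * (4 * L * lam)) < 1"
proof -
  have UM: "U ^ 2 * M > 0" using U M by simp
  then have H0: "H > 0" using H by linarith
  have "9 * U ^ 4 * M ^ 2 = (3 * U ^ 2 * M) ^ 2" by (simp add: power_mult_distrib flip: power_mult)
  also have "\<dots> \<le> H ^ 2" by (rule power_mono) (use H UM in linarith)+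
  finally have h2: "9 * U ^ 4 * M ^ 2 \<le> H ^ 2" .
  have "U ^ 3 * M ^ 2 \<le> U ^ 4 * M ^ 2" using U by (intro mult_right_mono power_increasing) auto
  then have "9 * (U ^ 3 * M ^ 2) \<le> H ^ 2" using h2 by linarith
  then have "2 * U ^ 3 * M ^ 2 / H ^ 2 \<le> 2 / 9" using H0 by (simp add: divide_simps mult_ac)
  then have t1: "(U * H * M) * (2 * U ^ 2 * M / H ^ 3) \<le> 2 / 9"
    using H0 by (simp add: power2_eq_square power3_eq_cube field_simps)
  have "H ^ 2 \<le> (4 * U ^ 2 * M) ^ 2" using H H0 by (intro power_mono) auto
  also have "\<dots> = 16 * U ^ 4 * M ^ 2" by (simp add: power_mult_distrib flip: power_mult)
  finally have "U ^ 2 * M ^ 2 * H ^ 2 \<le> U ^ 2 * M ^ 2 * (16 * U ^ 4 * M ^ 2)" using U M by (intro mult_left_mono) auto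
  also have "\<dots> = 16 * U ^ 6 * M ^ 4" by (simp add: power_numeral_reduce)
  also have "U ^ 2 * M ^ 2 * H ^ 2 = (U * H * M) * (U * H * M)" by (simp add: power2_eq_square mult_ac)
  finally have h: "(U * H * M) * (U * H * M) \<le> 16 * U ^ 6 * M ^ 4" .
  have "(U * H * M) * (U * H * M) * e \<le> 16 * U ^ 6 * M ^ 4 * e" using h e by (intro mult_right_mono) auto
  then have t2: "(U * H * M) * (U * H * M) * e \<le> 1 / 3" using e by linarith
  have "(U * H * M) * (U * H * M) * (4 * L * lam) \<le> 16 * U ^ 6 * M ^ 4 * (4 * U * lam)"
    by (rule mult_mono[OF h]) (use U lam M in \<open>auto intro: mult_right_mono\<close>)
  also have "\<dots> = 64 * U ^ 7 * M ^ 4 * lam" by (simp add: power_numeral_reduce)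
  finally have t3: "(U * H * M) * (U * H * M) * (4 * L * lam) < 1 / 3" using lam by linarith
  have "(U * H * M) * (2 * U ^ 2 * M / H ^ 3 + U * H * M * e + U * H * M * (4 * L * lam))
    = (U * H * M) * (2 * U ^ 2 * M / H ^ 3) + (U * H * M) * (U * H * M) * e + (U * H * M) * (U * H * M) * (4 * L * lam)"
    by (simp only: distrib_left mult.assoc)
  then show ?thesis using t1 t2 t3 by linarith
qed

lemma ln_le_thousandth: "ln U \<le> U / 1000 + 999" if "U > 0" for U :: real
proof -
  have "ln U = ln (U / 1000) + ln 1000" using that by (simp flip: ln_mult_pos)
  then show ?thesis using ln_le_minus_one[of "U / 1000"] ln_le_minus_one[of 1000] that by simp
qed

text \<open>All quantities are measured against \<open>q = L ^ 2 * j\<close>: \<open>U\<close> is at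
  least \<open>15000000 * q\<close> and \<open>E\<close> is \<open>40000 * q\<close>. The lower
  bound on \<open>L\<close> makes \<open>ln M\<close> at most \<open>U / 64 + E\<close>, so
  \<open>M ^ 4\<close> costs little more than \<open>exp (U / 16)\<close>, while the Taylor error
  supplies \<open>exp (- U / 8)\<close>.\<close>

lemma two_logs_params:
  fixes L L' K n :: nat and j T M E U :: real
  assumes L: "L = 8 * L'" "64 * (1 + ln (real n + 1)) \<le> real L" and n: "n > 0"
    and j: "j \<ge> 1" and K: "K = nat \<lfloor>16000000 * real L * j\<rfloor>"
    and E: "E = 40000 * real L ^ 2 * j" and M: "M = (exp 1 * (real n + 1)) ^ K * exp E" and U: "U = real (K * L)"
  shows "16000000 * real L * j - 1 \<le> K" "K \<le> 16000000 * real L * j" "K \<ge> 1" "L' \<ge> 1"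
    "exp 2 * E \<le> real (K * L')" "1 \<le> M" "real L \<le> U" "U \<ge> 10 ^ 9"
    "48 * U ^ 6 * M ^ 4 * exp (- real (K * L')) \<le> 1" "192 * U ^ 7 * M ^ 4 * exp (- U) < 1"
proof -
  have lnn: "0 \<le> ln (real n + 1)" by simp
  then have L64: "64 \<le> real L" using L by (smt (verit))
  then show L'1: "L' \<ge> 1" using L by simp
  have Lj: "64 \<le> real L * j" using mult_mono[of 64 "real L" 1 j] L64 j by simp
  have "0 \<le> 16000000 * real L * j" using j by simp
  then have floor: "real K = of_int \<lfloor>16000000 * real L * j\<rfloor>" unfolding K by simp
  show K1: "16000000 * real L * j - 1 \<le> K" and K2: "K \<le> 16000000 * real L * j"
    unfolding floor by linarith+
  show K0: "K \<ge> 1" using K1 Lj by linarith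
  define q where "q = real L ^ 2 * j"
  have q: "q = real L * (real L * j)" by (simp add: q_def power2_eq_square)
  have q1: "real L \<le> q" "4096 \<le> q" unfolding q using Lj L64 mult_mono[of 1 "real L * j" "real L" "real L"]
     mult_mono[of 64 "real L" 64 "real L * j"] by (auto simp: mult.commute)
  have Ul: "15000000 * q \<le> U"
  proof -
    have "(16000000 * real L * j - 1) * real L \<le> real K * real L" using K1 by (intro mult_right_mono) auto
    then have "16000000 * q - real L \<le> U" by (simp add: U q algebra_simps)
    then show ?thesis using q1 by linarith
  qed
  show "U \<ge> 10 ^ 9" using Ul q1 by simp
  show LU: "real L \<le> U" using Ul q1 by linarith
  have P: "real (K * L') = U / 8" by (simp add: U L)
  have e2: "exp 2 \<le> (9 :: real)"
  proof -
    have "exp 2 = exp 1 * (exp 1 :: real)" by (simp flip: exp_add)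
    also have "\<dots> \<le> 3 * 3" using exp_le by (intro mult_mono) auto
    finally show ?thesis by simp
  qed
  have Eq: "E = 40000 * q" by (simp add: E q_def)
  have "exp 2 * E \<le> 9 * (40000 * q)" unfolding Eq using e2 q1 by (intro mult_right_mono) auto
  also have "\<dots> \<le> U / 8" using Ul q1 by simp
  finally show "exp 2 * E \<le> real (K * L')" unfolding P .
  have E0: "E \<ge> 0" using Eq q1 by simp
  have "1 * 1 \<le> exp 1 * (real n + 1)" using one_le_exp_iff[of "1::real"] by (intro mult_mono) auto
  then have "1 * 1 \<le> (exp 1 * (real n + 1)) ^ K * exp E" using E0 by (intro mult_mono one_le_power) auto
  then show M1: "1 \<le> M" unfolding M by simp
  have lnM: "ln M = K * (1 + ln (real n + 1)) + E"
    unfolding M by (simp add: ln_mult_pos ln_realpow)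
  have "K * (1 + ln (real n + 1)) \<le> K * (real L / 64)" using L by (intro mult_left_mono) auto
  then have lnM2: "ln M \<le> U / 64 + 40000 * q" unfolding lnM Eq by (simp add: U)
  have U0: "U > 0" using Ul q1 by linarith
  have main: "192 * U ^ 6 * M ^ 4 \<le> exp (U / 8)"
  proof -
    have ln192: "ln (192::real) \<le> 191" using ln_le_minus_one[of "192::real"] by simp
    have "ln (192 * U ^ 6 * M ^ 4) = ln 192 + 6 * ln U + 4 * ln M"
      using U0 M1 by (simp add: ln_mult_pos ln_realpow)
    also have "\<dots> \<le> 191 + 6 * (U / 1000 + 999) + 4 * (U / 64 + 40000 * q)"
      by (intro add_mono mult_left_mono ln192 lnM2 ln_le_thousandth[OF U0]) simp_all
    also have "\<dots> \<le> U / 8" using Ul q1(2) by (simp add: field_simps)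
    finally have "ln (192 * U ^ 6 * M ^ 4) \<le> U / 8" .
    then have "exp (ln (192 * U ^ 6 * M ^ 4)) \<le> exp (U / 8)" by simp
    then show ?thesis using U0 M1 by simp
  qed
  then have "48 * U ^ 6 * M ^ 4 \<le> exp (U / 8)" using U0 M1
    by (smt (verit) mult_right_mono zero_le_power)
  then show "48 * U ^ 6 * M ^ 4 * exp (- real (K * L')) \<le> 1"
    unfolding P by (simp add: exp_minus divide_simps)
  have "ln U < U / 2" using ln_le_thousandth[OF U0] Ul q1 by linarith
  then have "U < exp (U / 2)" using U0 by (metis exp_less_cancel_iff exp_ln)
  then have "U * (192 * U ^ 6 * M ^ 4) < exp (U / 2) * exp (U / 8)"
    using main U0 M1 by (intro mult_less_le_imp_less) auto
  also have "\<dots> \<le> exp U" using U0 by (simp flip: exp_add)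
  finally have "192 * U ^ 7 * M ^ 4 < exp U" by (simp add: power_numeral_reduce mult_ac)
  then show "192 * U ^ 7 * M ^ 4 * exp (- U) < 1" by (simp add: exp_minus divide_simps)
qed

text \<open>Modulo \<open>n\<close> the factor \<open>m\<close> is invertible, so the sum determines
  the residue of \<open>r\<close>, and \<open>R \<le> n\<close> makes the residue determine
  \<open>r\<close>. This provides the distinct abscissae for the zero estimate.\<close>

lemma inj_on_linear_form:
  fixes m n R S :: nat
  assumes "coprime n m" "R \<le> n" "n > 0"
  shows "inj_on (\<lambda>(r,s). r * m + s * n) ({..<R} \<times> {..<S})"
proof (rule inj_onI, clarify)
  fix r s r' s' assume r: "r < R" "r' < R" and e: "r * m + s * n = r' * m + s' * n"
  have "[r * m = r' * m] (mod n)"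
    using e unfolding cong_def by (metis mod_mult_self1)
  then have "[r = r'] (mod n)" using assms(1) by (simp add: cong_mult_rcancel_nat coprime_commute)
  then have "r = r'" using r assms by (simp add: cong_def)
  then show "r = r' \<and> s = s'" using e assms by simp
qed

lemma abs_diff_le_max_ln:
  fixes x y :: real
  assumes "0 < x" "0 < y" shows "\<bar>x - y\<bar> \<le> max x y * \<bar>ln x - ln y\<bar>"
proof -
  have *: "p - q \<le> p * \<bar>ln p - ln q\<bar>" if "0 < p" "0 < q" for p q :: real
  proof -
    have "ln (q / p) \<le> q / p - 1" using that by (intro ln_le_minus_one) auto
    then have "ln q - ln p \<le> q / p - 1" using that by (simp add: ln_div)
    then have "p * (ln q - ln p) \<le> p * (q / p - 1)" using that by (intro mult_left_mono) auto
    then have "p - q \<le> p * (ln p - ln q)" using that by (simp add: algebra_simps)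
    also have "\<dots> \<le> p * \<bar>ln p - ln q\<bar>" using that by (intro mult_left_mono) auto
    finally show ?thesis .
  qed
  have "x - y \<le> max x y * \<bar>ln x - ln y\<bar>"
    by (rule order_trans[OF *]) (use assms in \<open>auto simp: abs_minus_commute intro!: mult_right_mono\<close>)
  moreover have "y - x \<le> max x y * \<bar>ln x - ln y\<bar>"
    by (rule order_trans[OF *]) (use assms in \<open>auto simp: abs_minus_commute intro!: mult_right_mono\<close>)
  ultimately show ?thesis by linarith
qed

lemma abs_ln_diff_le:
  fixes x y d :: real
  assumes "0 < x" "0 < y" "\<bar>x - y\<bar> \<le> d * x" "d \<le> 1 / 2"
  shows "\<bar>ln x - ln y\<bar> \<le> 2 * d"
proof -
  have d0: "0 \<le> d" using assms(1,3) abs_ge_zero order_trans zero_le_mult_iff by (metis less_le_not_le)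
  have "d * x \<le> 1 / 2 * x" using assms by (intro mult_right_mono) auto
  then have y: "x / 2 \<le> y" using assms by linarith
  have "ln y - ln x = ln (y / x)" using assms by (simp add: ln_div)
  also have "\<dots> \<le> y / x - 1" using assms by (intro ln_le_minus_one) auto
  also have "\<dots> = (y - x) / x" using assms by (simp add: diff_divide_distrib)
  also have "\<dots> \<le> d" using assms by (simp add: pos_divide_le_eq)
  finally have 1: "ln y - ln x \<le> d" .
  have "ln x - ln y = ln (x / y)" using assms by (simp add: ln_div)
  also have "\<dots> \<le> x / y - 1" using assms by (intro ln_le_minus_one) auto
  also have "\<dots> = (x - y) / y" using assms by (simp add: diff_divide_distrib)
  also have "\<dots> \<le> 2 * d"
  proof -
    have "x - y \<le> d * x" using assms by linarith
    also have "\<dots> \<le> d * (2 * y)" using y d0 by (intro mult_left_mono) auto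
    finally show ?thesis using assms by (simp add: pos_divide_le_eq)
  qed
  finally show ?thesis using 1 d0 by linarith
qed

context quad_pair begin

text \<open>Along \<open>x = r m + s n\<close>, \<open>y = \<alpha>\<^sup>r b\<^sup>s\<close> one has \<open>y \<approx> exp (c x)\<close> with \<open>c = ln b / n\<close>, up to an error governed by the
  linear form. Using binomial coefficients instead of powers of \<open>x\<close> keeps the bound free of \<open>ln (ln \<alpha>)\<close>.\<close>


lemma two_logs_coprime:
  fixes b :: int and n m L L' :: nat
  assumes \<alpha>: "3 \<le> ln \<alpha>" "0 < \<alpha>" "\<bar>\<beta>\<bar> \<le> \<alpha>" and b: "b \<ge> 2"
    and nm: "coprime n m" "n > 0"
    and L: "L = 8 * L'" "64 * (1 + ln (real n + 1)) \<le> real L"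
    and n: "4000 * real L * ln b \<le> real n"
  shows "exp (- ((4000 * real L) ^ 2 * (ln \<alpha> * ln b))) \<le> \<bar>n * ln \<alpha> - m * ln b\<bar>"
proof (rule ccontr)
  assume neg: "\<not> ?thesis"
  define a where "a = ln \<alpha>"
  define lb where "lb = ln (real_of_int b)"
  \<comment> \<open>\<open>T\<close> scales the box: \<open>R\<close> is about \<open>T * lb\<close>
    and \<open>S\<close> about \<open>T * a\<close>, so that \<open>R * S\<close> reaches
    \<open>T ^ 2 * j\<close>, hence \<open>K * L\<close>, as the zero estimate requires. The negated
    claim reads \<open>lam < exp (- (T ^ 2 * j))\<close>.\<close>
  define T where "T = 4000 * real L"
  define j where "j = a * lb"
  define lam where "lam = \<bar>n * a - m * lb\<bar>"
  define K where "K = nat \<lfloor>16000000 * real L * j\<rfloor>"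
  define E where "E = 40000 * real L ^ 2 * j"
  define w where "w = real n + 1"
  define M where "M = (exp 1 * w) ^ K * exp E"
  define U where "U = real (K * L)"
  define H where "H = nat \<lceil>3 * U ^ 2 * M\<rceil>"
  define R where "R = nat \<lceil>T * lb\<rceil>"
  define S where "S = nat \<lceil>T * a\<rceil>"
  define X where "X = real (2 * R * m + 2 * S * n)"
  define c where "c = lb / n"
  define I where "I = {..<K} \<times> {..<L}"
  have rb: "real_of_int b \<ge> 2" using b by simp
  have a3: "a \<ge> 3" using \<alpha> by (simp add: a_def)
  have lb: "lb \<ge> 1 / 2" unfolding lb_def using rb by (rule ln_ge_half)
  have j: "j \<ge> 1" "3 * lb \<le> j" "a \<le> 2 * j"
    using mult_mono[of 3 a "1/2" lb] mult_right_mono[OF a3, of lb] mult_left_mono[OF lb, of a] a3 lb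
    by (auto simp: j_def)
  note par = two_logs_params[OF L nm(2) j(1) K_def E_def M_def[unfolded w_def] U_def]
  have L64: "real L \<ge> 64" using L(2) by (smt (verit) ln_ge_zero of_nat_0_le_iff)
  have T: "T \<ge> 256000" using L64 by (simp add: T_def)
  have UT: "U \<le> T ^ 2 * j"
  proof -
    have "real K * real L \<le> (16000000 * real L * j) * real L" using par(2) by (intro mult_right_mono) auto
    then show ?thesis by (simp add: U_def T_def power2_eq_square mult_ac)
  qed
  have lamT: "lam < exp (- (T ^ 2 * j))"
    using neg by (simp add: lam_def T_def j_def a_def lb_def)
  have lamU: "lam < exp (- U)"
    by (rule less_le_trans[OF lamT]) (use UT in simp)
  have U0: "U \<ge> 1" using par(8) by simp
  have lam1: "lam < 1" using lamU U0 by (smt (verit) exp_le_one_iff)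
  have lam0: "lam \<ge> 0" by (simp add: lam_def)
  \<comment> \<open>Keeps the differences of exponents within the range where
    \<open>exp d - 1\<close> is at most twice \<open>d\<close> in absolute value.\<close>
  have Llam: "2 * real L * lam \<le> 1"
  proof -
    have "real L * lam \<le> U * exp (- U)" using par(7) lamU lam0 U0 by (intro mult_mono) auto
    moreover have "U * exp (- U) \<le> 1 / 2"
    proof -
      have "2 * U \<le> (1 + U / 2) ^ 2" using zero_le_power2[of "1 - U / 2"] by (simp add: power2_eq_square algebra_simps)
      also have "\<dots> \<le> exp (U / 2) ^ 2" using U0 by (intro power_mono exp_ge_add_one_self) auto
      also have "\<dots> = exp U" by (simp add: power2_eq_square flip: exp_add)
      finally show ?thesis by (simp add: exp_minus divide_simps)
    qed
    ultimately show ?thesis by linarith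
  qed
  have mlb: "m * lb \<le> n * a + 1" using lam1 by (simp add: lam_def)
  have Tlb: "T * lb \<ge> 1" using mult_mono[of 2 T "1/2" lb] T lb by simp
  have Ta: "T * a \<ge> 1" using mult_mono[of 1 T 1 a] T a3 by simp
  have R: "T * lb \<le> R" "R \<le> 2 * T * lb" using Tlb unfolding R_def by linarith+
  have S: "T * a \<le> S" "S \<le> 2 * T * a" using Ta unfolding S_def by linarith+
  have Rn: "R \<le> n"
    using n unfolding R_def T_def lb_def by (simp add: nat_le_iff ceiling_le_iff)
  have SL: "L \<le> S"
  proof -
    have "real L \<le> T * a" using mult_mono[of "real L" T 1 a] a3 T by (simp add: T_def)
    then show ?thesis using S by linarith
  qed
  have RS: "U \<le> real (R * S)"
  proof -
    have "T ^ 2 * j = (T * lb) * (T * a)" by (simp add: j_def power2_eq_square)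
    also have "\<dots> \<le> real R * real S" using R S Tlb Ta by (intro mult_mono) auto
    finally show ?thesis using UT by simp
  qed
  have na: "1 \<le> n * a" using mult_mono[of 1 "real n" 1 a] nm a3 by simp
  have X0: "X > 0" using S Ta nm by (simp add: X_def add_nonneg_pos)
  \<comment> \<open>\<open>X\<close> is at most \<open>48000 * n * L * a\<close>, and
    \<open>K\<close> is at least \<open>48000 * L * a\<close> because \<open>a \<le> 2 * j\<close>.
    So \<open>a\<close> cancels and \<open>w = n + 1\<close> suffices.\<close>
  have Xw: "X + real K \<le> w * real K"
  proof -
    have "real R * m \<le> 2 * T * lb * m" using R by (intro mult_right_mono) auto
    also have "\<dots> = 2 * T * (m * lb)" by simp
    also have "\<dots> \<le> 2 * T * (2 * (n * a))" using mlb na T by (intro mult_left_mono) auto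
    finally have 1: "real R * m \<le> 4 * T * (n * a)" by simp
    have "real S * n \<le> 2 * T * a * n" using S by (intro mult_right_mono) auto
    with 1 have "X \<le> 12 * (T * n * a)" by (simp add: X_def mult_ac)
    also have "\<dots> = 48000 * (real n * (real L * a))" by (simp add: T_def)
    also have "\<dots> \<le> real n * K"
    proof -
      have "real L * a \<ge> 1" using mult_mono[of 1 "real L" 1 a] L64 a3 by simp
      moreover have "real L * a \<le> 2 * (real L * j)" using mult_left_mono[OF j(3), of "real L"] by simp
      ultimately have "48000 * (real L * a) \<le> K" using par(1) by linarith
      then have "real n * (48000 * (real L * a)) \<le> real n * K" by (intro mult_left_mono) auto
      then show ?thesis by (simp only: mult_ac)
    qed
    finally show ?thesis by (simp add: w_def algebra_simps)
  qed
  \<comment> \<open>On the doubled box the exponents are at most \<open>10 * L * T * j\<close>,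
    which is \<open>E\<close> since \<open>T = 4000 * L\<close>.\<close>
  have LcX: "real L * c * X \<le> E"
  proof -
    have "c * X = 2 * (real R * (m * lb / n)) + 2 * (real S * lb)" using nm by (simp add: c_def X_def field_simps)
    also have "m * lb / n \<le> a + 1"
    proof -
      have "m * lb \<le> (a + 1) * n" using mlb nm by (simp add: algebra_simps) 
      then show ?thesis using nm by (simp add: pos_divide_le_eq)
    qed
    then have "real R * (m * lb / n) \<le> 2 * T * lb * (a + 1)" using R a3 T lb by (intro mult_mono) (auto simp: lb_def)
    then have "2 * (real R * (m * lb / n)) + 2 * (real S * lb) \<le> 2 * (2 * T * lb * (a + 1)) + 2 * (2 * T * a * lb)"
      using mult_right_mono[OF S(2), of lb] lb by linarith
    also have "\<dots> = 8 * (T * j) + 4 * (T * lb)" by (simp add: j_def algebra_simps)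
    also have "\<dots> \<le> 10 * (T * j)"
    proof -
      have "T * (3 * lb) \<le> T * j" using j T by (intro mult_left_mono) auto
      then show ?thesis using Tlb by linarith
    qed
    finally have "real L * (c * X) \<le> real L * (10 * (T * j))" by (intro mult_left_mono) auto
    then show ?thesis by (simp add: E_def T_def power2_eq_square mult_ac)
  qed
  have M1: "M \<ge> 1" using par(6) by (simp add: M_def w_def)
  have UM: "1 \<le> U ^ 2 * M" using mult_mono[of 1 "U ^ 2" 1 M] U0 M1 by (simp add: one_le_power)
  have H: "3 * U ^ 2 * M \<le> H" "H \<le> 4 * U ^ 2 * M" "H \<ge> 1"
    using UM unfolding H_def by linarith+
  have w1: "w \<ge> 1" and c0: "c \<ge> 0" using lb by (auto simp: w_def c_def)
  obtain p where p: "\<And>i. i \<in> I \<Longrightarrow> \<bar>p i\<bar> \<le> int H" "\<exists>i\<in>I. p i \<noteq> 0"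
    "\<And>z. 0 \<le> z \<Longrightarrow> z \<le> X \<Longrightarrow> \<bar>\<Sum>(k,l)\<in>I. of_int (p (k,l)) * (z gchoose k) * exp (real l * c * z)\<bar>
      \<le> 2 * U ^ 2 * M / H ^ 3 + U * H * M * exp (- real (K * L'))"
    using auxiliary_function[OF par(3) L(1) par(4) X0 c0 w1 Xw LcX par(5) M_def H(3)]
    unfolding I_def U_def by blast
  have cardI: "real (card I) = U" by (simp add: I_def U_def)
  define V where "V x y = (\<Sum>(k,l)\<in>I. of_int (p (k,l)) * real (x choose k) * y ^ l)" for x :: nat and y :: real
  \<comment> \<open>Liouville's inequality: the value is small by the choice of \<open>p\<close> and
    the smallness of \<open>lam\<close>, its conjugate is at most \<open>U * H * M\<close>, and the
    product is below 1. The box is doubled to leave room for the translates in the zero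
    estimate.\<close>
  have V0: "V (r * m + s * n) (\<alpha> ^ r * of_int b ^ s) = 0" if rs: "r < 2 * R" "s < 2 * S" for r s
  proof (rule ccontr)
    assume nz: "V (r * m + s * n) (\<alpha> ^ r * of_int b ^ s) \<noteq> 0"
    define x where "x = r * m + s * n"
    define z where "z = real x"
    define y where "y = \<alpha> ^ r * real_of_int b ^ s"
    have "x \<le> 2 * R * m + 2 * S * n" unfolding x_def using rs by (intro add_mono mult_right_mono) auto
    then have z: "0 \<le> z" "z \<le> X" by (auto simp: z_def X_def simp flip: of_nat_add of_nat_mult)
    have ew0: "(exp 1 * w) ^ K > 0" using w1 by simp
    have bin: "\<bar>real (x choose k)\<bar> \<le> (exp 1 * w) ^ K" if "k < K" for k
    proof -
      have "z + K \<le> w * K" using z Xw by linarith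
      then have "l1_norm (binom_poly z k) \<le> (exp 1 * w) ^ K" using that w1 z by (intro l1_norm_binom_poly) auto
      then have "\<bar>z gchoose k\<bar> \<le> (exp 1 * w) ^ K"
        using abs_poly_le_l1_norm[of 1 "binom_poly z k"] by (simp add: poly_binom_poly)
      then show ?thesis by (simp add: z_def binomial_gbinomial)
    qed
    have y: "y = exp (r * a + s * lb)"
      using \<alpha> rb by (simp add: y_def a_def lb_def exp_add exp_of_nat_mult)
    \<comment> \<open>The part with \<open>s\<close> cancels since \<open>c * n = lb\<close>. What
      remains is \<open>r / n * lam\<close>, where \<open>r < 2 * R \<le> 2 * n\<close>.\<close>
    have yz: "\<bar>(r * a + s * lb) - c * z\<bar> \<le> 2 * lam"
    proof -
      have "(r * a + s * lb) - c * z = r / n * (n * a - m * lb)"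
        using nm by (simp add: c_def z_def x_def field_simps)
      then have "\<bar>(r * a + s * lb) - c * z\<bar> = r / n * lam" by (simp add: lam_def abs_mult)
      also have "\<dots> \<le> 2 * lam" using rs Rn nm lam0 by (intro mult_right_mono) (auto simp: divide_simps)
      finally show ?thesis .
    qed
    have lcz: "real l * c * z \<le> E" if "l < L" for l
    proof -
      have "real l * (c * z) \<le> real L * (c * X)" using that z c0 by (intro mult_mono) auto
      then show ?thesis using LcX by simp
    qed
    have yl: "\<bar>y ^ l - exp (real l * c * z)\<bar> \<le> exp E * (4 * real L * lam)" if l: "l < L" for l
    proof -
      define d where "d = real l * ((r * a + s * lb) - c * z)"
      have "\<bar>d\<bar> \<le> real L * (2 * lam)" unfolding d_def abs_mult using l yz lam0 by (intro mult_mono) auto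
      then have d: "\<bar>d\<bar> \<le> 2 * real L * lam" by simp
      have "y ^ l = exp (real l * c * z) * exp d"
        unfolding y by (simp add: exp_of_nat_mult[symmetric] exp_add[symmetric] d_def algebra_simps)
      then have "y ^ l - exp (real l * c * z) = exp (real l * c * z) * (exp d - 1)" by (simp add: algebra_simps)
      also have "\<bar>\<dots>\<bar> \<le> exp E * (2 * \<bar>d\<bar>)"
        unfolding abs_mult using lcz[OF l] abs_exp_minus_1_le[of d] d Llam by (intro mult_mono) auto
      also have "\<dots> \<le> exp E * (4 * real L * lam)"
      proof (rule mult_left_mono)
        show "2 * \<bar>d\<bar> \<le> 4 * real L * lam" using d by linarith
      qed simp
      finally show ?thesis .
    qed
    have pH: "\<bar>real_of_int (p i)\<bar> \<le> H" if "i \<in> I" for i using p(1)[OF that] by linarith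
    define F where "F = (\<Sum>(k,l)\<in>I. of_int (p (k,l)) * (z gchoose k) * exp (real l * c * z))"
    have "V x y - F = (\<Sum>(k,l)\<in>I. of_int (p (k,l)) * real (x choose k) * (y ^ l - exp (real l * c * z)))"
      unfolding V_def F_def sum_subtractf[symmetric]
      by (rule sum.cong) (auto simp: z_def binomial_gbinomial algebra_simps)
    also have "\<bar>\<dots>\<bar> \<le> (\<Sum>(k,l)\<in>I. \<bar>of_int (p (k,l)) * real (x choose k) * (y ^ l - exp (real l * c * z))\<bar>)"
      by (rule order_trans[OF sum_abs]) (auto simp: case_prod_unfold)
    also have "\<dots> \<le> (\<Sum>i\<in>I. H * (exp 1 * w) ^ K * (exp E * (4 * real L * lam)))"
    proof (rule sum_mono, clarify)
      fix k l assume kl: "(k, l) \<in> I"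
      then have "k < K" "l < L" by (auto simp: I_def)
      then show "\<bar>of_int (p (k,l)) * real (x choose k) * (y ^ l - exp (real l * c * z))\<bar>
        \<le> H * (exp 1 * w) ^ K * (exp E * (4 * real L * lam))"
        unfolding abs_mult[of "_ * _"] abs_mult[of "of_int _"]
        using pH[OF kl] bin yl ew0 by (intro mult_mono) auto
    qed
    also have "\<dots> = U * H * M * (4 * real L * lam)" by (simp add: cardI M_def)
    finally have VF: "\<bar>V x y - F\<bar> \<le> U * H * M * (4 * real L * lam)" .
    have "\<bar>F\<bar> \<le> 2 * U ^ 2 * M / H ^ 3 + U * H * M * exp (- real (K * L'))"
      unfolding F_def by (rule p(3)[OF z])
    with VF have Vub: "\<bar>V x y\<bar> \<le> 2 * U ^ 2 * M / H ^ 3 + U * H * M * exp (- real (K * L')) + U * H * M * (4 * real L * lam)"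
      by linarith
    define y' where "y' = \<beta> ^ r * real_of_int b ^ s"
    have y': "\<bar>y'\<bar> ^ l \<le> exp E" if l: "l < L" for l
    proof -
      have "\<bar>y'\<bar> \<le> y" unfolding y'_def y_def abs_mult power_abs
        using \<alpha> rb by (intro mult_mono power_mono) auto
      then have "\<bar>y'\<bar> ^ l \<le> y ^ l" by (intro power_mono) auto
      also have "\<dots> = exp (real l * (r * a + s * lb))" unfolding y by (simp add: exp_of_nat_mult)
      also have "\<dots> \<le> exp E"
      proof -
        have "real r \<le> 2 * real R" "real s \<le> 2 * real S" using rs by linarith+
        then have "real r \<le> 4 * T * lb" "real s \<le> 4 * T * a" using R S by linarith+
        then have "r * a + s * lb \<le> (4 * T * lb) * a + (4 * T * a) * lb" 
          using a3 lb by (intro add_mono mult_right_mono) auto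
        also have "\<dots> \<le> 10 * (T * j)" using T j by (simp add: j_def)
        finally have "real l * (r * a + s * lb) \<le> real L * (10 * (T * j))"
          using l a3 lb by (intro mult_mono) auto
        also have "\<dots> = E" by (simp add: E_def T_def power2_eq_square)
        finally show ?thesis by simp
      qed
      finally show ?thesis .
    qed
    have "\<bar>V x y'\<bar> \<le> (\<Sum>(k,l)\<in>I. \<bar>of_int (p (k,l)) * real (x choose k) * y' ^ l\<bar>)"
      unfolding V_def by (rule order_trans[OF sum_abs]) (auto simp: case_prod_unfold)
    also have "\<dots> \<le> (\<Sum>i\<in>I. H * (exp 1 * w) ^ K * exp E)"
    proof (rule sum_mono, clarify)
      fix k l assume kl: "(k, l) \<in> I"
      then have "k < K" "l < L" by (auto simp: I_def)
      then show "\<bar>of_int (p (k,l)) * real (x choose k) * y' ^ l\<bar> \<le> H * (exp 1 * w) ^ K * exp E"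
        unfolding abs_mult[of "_ * _"] abs_mult[of "of_int _"] power_abs
        using pH[OF kl] bin y' ew0 by (intro mult_mono) auto
    qed
    also have "\<dots> = U * H * M" by (simp add: cardI M_def)
    finally have V'ub: "\<bar>V x y'\<bar> \<le> U * H * M" .
    have "conj_pair (V x y) (V x y')"
      unfolding V_def
    proof (rule conj_pair_sum, clarify)
      fix k l
      have "conj_pair y y'" unfolding y_def y'_def by blast
      moreover have "conj_pair (real (x choose k)) (real (x choose k))"
        using conj_pair_of_int[of "int (x choose k)"] by simp
      ultimately show "conj_pair (of_int (p (k,l)) * real (x choose k) * y ^ l) (of_int (p (k,l)) * real (x choose k) * y' ^ l)"
        by blast
    qed
    then have "1 \<le> \<bar>V x y'\<bar> * \<bar>V x y\<bar>"
      using conj_pair_norm_ge_1 nz unfolding x_def y_def by (metis mult.commute)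
    also have "\<dots> \<le> (U * H * M) * (2 * U ^ 2 * M / H ^ 3 + U * H * M * exp (- real (K * L')) + U * H * M * (4 * real L * lam))"
      using Vub V'ub U0 M1 by (intro mult_mono) auto
    also have "\<dots> < 1"
      unfolding of_nat_power
    proof (rule two_logs_size)
      have "192 * U ^ 7 * M ^ 4 * lam \<le> 192 * U ^ 7 * M ^ 4 * exp (- U)"
        using lamU U0 M1 by (intro mult_left_mono) auto
      also have "\<dots> < 1" using par(10) by (simp add: M_def w_def)
      finally show "192 * U ^ 7 * M ^ 4 * lam < 1" .
      show "48 * U ^ 6 * M ^ 4 * exp (- real (K * L')) \<le> 1" using par(9) by (simp add: M_def w_def)
    qed (use U0 L64 par(7) M1 H lam0 in auto)
    finally show False by simp
  qed
  define Q where "Q l = (\<Sum>k<K. Polynomial.smult (of_int (p (k,l))) (binom_poly 1 k))" for l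
  have polyQ: "poly (Q l) (real x) = (\<Sum>k<K. of_int (p (k,l)) * real (x choose k))" for l x
    by (simp add: Q_def poly_sum poly_binom_poly binomial_gbinomial)
  obtain k1 l0 where kl: "k1 < K" "l0 < L" "p (k1, l0) \<noteq> 0" using p(2) by (auto simp: I_def)
  \<comment> \<open>At \<open>x = k0\<close> the binomial coefficients with larger lower index
    vanish, and the smaller indices have coefficient 0. A single nonzero term is left, so
    \<open>Q l0\<close> is not the zero polynomial.\<close>
  define k0 where "k0 = (LEAST k. p (k, l0) \<noteq> 0)"
  have k0: "p (k0, l0) \<noteq> 0" "k0 \<le> k1" "\<And>k. k < k0 \<Longrightarrow> p (k, l0) = 0"
    using LeastI[of "\<lambda>k. p (k, l0) \<noteq> 0", OF kl(3)] Least_le[of "\<lambda>k. p (k, l0) \<noteq> 0", OF kl(3)]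
      not_less_Least[of _ "\<lambda>k. p (k, l0) \<noteq> 0"] unfolding k0_def by blast+
  have "poly (Q l0) (real k0) = (\<Sum>k\<in>{k0}. of_int (p (k,l0)) * real (k0 choose k))"
    unfolding polyQ
  proof (rule sum.mono_neutral_right)
    show "\<forall>i\<in>{..<K} - {k0}. of_int (p (i, l0)) * real (k0 choose i) = 0"
      using k0(3) by (auto simp: binomial_eq_0 neq_iff)
  qed (use k0 kl in auto)
  then have Q0: "Q l0 \<noteq> 0" using k0(1) by auto
  \<comment> \<open>The translates are taken along \<open>r = 0\<close>, where the \<open>y\<close>-coordinates are the distinct powers of \<open>b\<close>.\<close>
  show False
  proof (rule zero_estimate[where Q = Q and D = "K - 1" and L = L and u = "\<lambda>i. of_int b ^ i"
        and a = "\<lambda>i. real (i * n)" and I = "{..<R} \<times> {..<S}" and x = "\<lambda>(r,s). real (r * m + s * n)"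
        and y = "\<lambda>(r,s). \<alpha> ^ r * of_int b ^ s"])
    show "degree (Q l) \<le> K - 1" for l
      unfolding Q_def
    proof (rule degree_sum_le)
      fix k assume "k \<in> {..<K}"
      then show "degree (Polynomial.smult (of_int (p (k,l))) (binom_poly 1 k)) \<le> K - 1"
        using degree_smult_le[of "of_int (p (k,l))" "binom_poly 1 k"] degree_binom_poly[of 1 k] by fastforce
    qed simp
    show "inj_on (\<lambda>i. real_of_int b ^ i) {..<L}"
      using rb by (intro inj_onI) (simp add: power_inject_exp)
    show "inj_on (\<lambda>(r,s). real (r * m + s * n)) ({..<R} \<times> {..<S})"
      using inj_on_linear_form[OF nm(1) Rn nm(2), of S] unfolding inj_on_def by (auto simp del: of_nat_add of_nat_mult)
    have "L > 0" using L64 by (cases L) auto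
    then have "(K - 1) * L < K * L" using par(3) by (intro mult_strict_right_mono) auto
    moreover have "K * L \<le> R * S" using RS unfolding U_def of_nat_le_iff .
    ultimately have "(K - 1) * L < R * S" by (rule less_le_trans)
    then show "(K - 1) * L < card ({..<R} \<times> {..<S})" by simp
    fix i k assume i: "i \<in> {..<R} \<times> {..<S}" and k: "k < L"
    obtain r s where rs: "i = (r,s)" "r < R" "s < S" using i by auto
    \<comment> \<open>Translation by index \<open>k\<close> replaces \<open>s\<close> by
      \<open>s + k\<close>. As \<open>L \<le> S\<close>, this stays below \<open>2 * S\<close>, so
      \<open>V0\<close> applies.\<close>
    have "(\<Sum>l<L. poly (Q l) (real (r * m + s * n) + real (k * n)) * (of_int b ^ k * (\<alpha> ^ r * of_int b ^ s)) ^ l)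
      = (\<Sum>l<L. \<Sum>k'<K. of_int (p (k',l)) * real ((r * m + (s + k) * n) choose k') * (\<alpha> ^ r * of_int b ^ (s + k)) ^ l)"
    proof (rule sum.cong[OF refl])
      fix l
      have "real (r * m + s * n) + real (k * n) = real (r * m + (s + k) * n)" by (simp add: algebra_simps)
      moreover have "of_int b ^ k * (\<alpha> ^ r * of_int b ^ s) = \<alpha> ^ r * of_int b ^ (s + k)" by (simp add: power_add mult_ac)
      ultimately show "poly (Q l) (real (r * m + s * n) + real (k * n)) * (of_int b ^ k * (\<alpha> ^ r * of_int b ^ s)) ^ l
         = (\<Sum>k'<K. of_int (p (k',l)) * real ((r * m + (s + k) * n) choose k') * (\<alpha> ^ r * of_int b ^ (s + k)) ^ l)"
        by (simp only: polyQ sum_distrib_right)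
    qed
    also have "\<dots> = V (r * m + (s + k) * n) (\<alpha> ^ r * of_int b ^ (s + k))"
      unfolding V_def I_def by (subst sum.swap) (simp add: sum.cartesian_product)
    also have "\<dots> = 0" using V0[of r "s + k"] rs k SL by simp
    finally show "(\<Sum>l<L. poly (Q l) ((case i of (r,s) \<Rightarrow> real (r * m + s * n)) + real (k * n))
       * (of_int b ^ k * (case i of (r,s) \<Rightarrow> \<alpha> ^ r * of_int b ^ s)) ^ l) = 0"
      by (simp add: rs(1))
  qed (use kl Q0 \<alpha> rb in \<open>auto split: prod.splits\<close>)
qed

end

context quad_pair begin

text \<open>Dividing \<open>n\<close> and \<open>m\<close> by their gcd divides the form by a
  positive integer, so coprime exponents suffice. If the reduced \<open>n'\<close> is at least
  \<open>T * lb\<close>, the coprime case applies. If it is smaller, \<open>\<alpha> ^ n'\<close> is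
  so small that Liouville's inequality for \<open>\<alpha> ^ n' - b ^ m'\<close> already gives the
  bound.\<close>

lemma two_logs:
  fixes b :: int and n m L L' :: nat
  assumes \<alpha>: "3 \<le> ln \<alpha>" "0 < \<alpha>" "\<bar>\<beta>\<bar> < \<alpha>" and b: "b \<ge> 2" and n: "n > 0"
    and L: "L = 8 * L'" "64 * (1 + ln (real n + 1)) \<le> real L"
  shows "exp (- ((4000 * real L) ^ 2 * (ln \<alpha> * ln b))) \<le> \<bar>n * ln \<alpha> - m * ln b\<bar>"
proof -
  define a where "a = ln \<alpha>"
  define lb where "lb = ln (real_of_int b)"
  define T where "T = 4000 * real L"
  have "gcd n m \<noteq> 0" using n by simp
  then obtain n' m' where nm: "n = n' * gcd n m" "m = m' * gcd n m" "coprime n' m'"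
    using gcd_coprime_exists by metis
  have n': "n' > 0" using nm(1) n by (metis gr0I mult_0)
  have "n' * 1 \<le> n' * gcd n m" using n by (intro mult_left_mono) (auto simp: Suc_le_eq)
  then have n'n: "n' \<le> n" using nm(1) by simp
  have L': "64 * (1 + ln (real n' + 1)) \<le> real L"
  proof -
    have "64 * (1 + ln (real n' + 1)) \<le> 64 * (1 + ln (real n + 1))" using n'n by simp
    then show ?thesis using L(2) by (rule order_trans)
  qed
  have rb: "real_of_int b \<ge> 2" using b by simp
  have lb0: "lb > 0" using rb by (simp add: lb_def)
  have main: "exp (- (T ^ 2 * (a * lb))) \<le> \<bar>n' * a - m' * lb\<bar>"
  proof (cases "T * lb \<le> real n'")
    case True
    then show ?thesis
      using two_logs_coprime[OF \<alpha>(1,2) less_imp_le[OF \<alpha>(3)] b nm(3) n' L(1) L'] by (simp add: T_def a_def lb_def)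
  next
    case False
    define lam where "lam = \<bar>n' * a - m' * lb\<bar>"
    define x where "x = \<alpha> ^ n'"
    define y where "y = real_of_int b ^ m'"
    have x: "x = exp (n' * a)" using \<alpha> by (simp add: x_def a_def exp_of_nat_mult)
    have y: "y = exp (m' * lb)" using rb by (simp add: y_def lb_def exp_of_nat_mult)
    have a0: "a > 0" using \<alpha> unfolding a_def by linarith
    then have x1: "1 \<le> x" by (simp add: x)
    show ?thesis
    proof (cases "lam \<ge> 1")
      case True
      have "exp (- (T ^ 2 * (a * lb))) \<le> 1" using a0 lb0 by simp
      then show ?thesis using True unfolding lam_def by (rule order_trans)
    next
      case lam1: False
      have cp: "conj_pair (x - y) (\<beta> ^ n' - y)" unfolding x_def y_def
        using conj_pair_power[OF conj_pair_of_int[of b]] by blast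
      \<comment> \<open>If \<open>x = y\<close>, the conjugate would vanish too, giving
        \<open>\<beta> ^ n' = \<alpha> ^ n'\<close>; the dominance of \<open>\<alpha>\<close>
        excludes this.\<close>
      have "\<bar>\<beta>\<bar> ^ n' < \<alpha> ^ n'" using \<alpha> n' by (intro power_strict_mono) auto
      then have b': "\<bar>\<beta> ^ n'\<bar> < x" by (simp add: x_def power_abs)
      have "x - y \<noteq> 0" using conj_pair_eq_0_iff[OF cp] b' by auto
      then have 1: "1 \<le> \<bar>x - y\<bar> * \<bar>\<beta> ^ n' - y\<bar>" using conj_pair_norm_ge_1[OF cp] by simp
      have y3: "y \<le> 3 * x"
      proof -
        have "y \<le> exp (1 + n' * a)" unfolding y using lam1 by (simp add: lam_def)
        also have "\<dots> = exp 1 * x" by (simp add: x exp_add)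
        also have "\<dots> \<le> 3 * x" using exp_le x1 by (intro mult_right_mono) auto
        finally show ?thesis .
      qed
      have "\<bar>x - y\<bar> \<le> max x y * \<bar>ln x - ln y\<bar>" by (rule abs_diff_le_max_ln) (auto simp: x y)
      also have "\<dots> \<le> 3 * x * lam" using y3 x1 by (intro mult_mono) (auto simp: x y lam_def)
      finally have "\<bar>x - y\<bar> \<le> 3 * x * lam" .
      moreover have "\<bar>\<beta> ^ n' - y\<bar> \<le> 4 * x" using b' y3 y by (auto simp: abs_le_iff) (smt (verit) exp_gt_zero)+
      ultimately have "\<bar>x - y\<bar> * \<bar>\<beta> ^ n' - y\<bar> \<le> (3 * x * lam) * (4 * x)" by (intro mult_mono) (auto simp: lam_def)
      also have "\<dots> = 12 * (x * x) * lam" by (simp add: mult_ac)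
      finally have 2: "1 \<le> 12 * (x * x) * lam" using 1 by linarith
      have "64 \<le> 64 * (1 + ln (real n' + 1))" by simp
      then have "64 \<le> real L" using L' by (rule order_trans)
      then have T: "T \<ge> 256000" by (simp add: T_def)
      have "n' * a \<le> T * lb * a" using False a0 by (intro mult_right_mono) auto
      then have "x \<le> exp (T * (a * lb))" unfolding x by (simp add: mult_ac)
      then have "x * x \<le> exp (T * (a * lb)) * exp (T * (a * lb))" using x1 by (intro mult_mono) auto
      also have "\<dots> = exp (2 * (T * (a * lb)))" by (simp flip: exp_add)
      finally have xx: "x * x \<le> exp (2 * (T * (a * lb)))" .
      have "12 \<le> exp (11::real)" using exp_ge_add_one_self[of 11] by simp
      then have "12 * (x * x) \<le> exp 11 * exp (2 * (T * (a * lb)))" using xx x1 by (intro mult_mono) auto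
      also have "\<dots> = exp (11 + 2 * (T * (a * lb)))" by (simp add: exp_add)
      also have "\<dots> \<le> exp (T ^ 2 * (a * lb))"
      proof -
        have "1 \<le> real n' * a" using n' \<alpha> mult_mono[of 1 "real n'" 1 a] by (simp add: a_def)
        then have Tab: "1 \<le> T * (a * lb)" using \<open>n' * a \<le> T * lb * a\<close> by (simp add: mult_ac)
        have "13 * (T * (a * lb)) \<le> T * (T * (a * lb))" using T Tab by (intro mult_right_mono) auto
        then show ?thesis using Tab by (simp add: power2_eq_square mult.assoc)
      qed
      finally have "12 * (x * x) * lam \<le> exp (T ^ 2 * (a * lb)) * lam" by (rule mult_right_mono) (simp add: lam_def)
      then have "1 \<le> exp (T ^ 2 * (a * lb)) * lam" using 2 by linarith
      then show ?thesis by (simp add: lam_def exp_minus divide_simps mult.commute)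
    qed
  qed
  have "real n * ln \<alpha> - real m * ln b = real (gcd n m) * (n' * a - m' * lb)"
    by (subst (1) nm(1), subst (1) nm(2)) (simp add: a_def lb_def algebra_simps)
  then have "\<bar>real n * ln \<alpha> - real m * ln b\<bar> = real (gcd n m) * \<bar>n' * a - m' * lb\<bar>" by (simp add: abs_mult)
  moreover have "1 * \<bar>n' * a - m' * lb\<bar> \<le> real (gcd n m) * \<bar>n' * a - m' * lb\<bar>"
    using n by (intro mult_right_mono) (auto simp: Suc_le_eq)
  ultimately show ?thesis using main by (simp add: T_def a_def lb_def)
qed

end

section \<open>Three solutions\<close>

lemma exp_sum3_bound:
  fixes K x y z :: real
  assumes "1 \<le> exp K * (exp (- x) + exp (- y) + exp (- z))"
  shows "x \<le> K + 2 \<or> y \<le> K + 2 \<or> z \<le> K + 2"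
proof (rule ccontr)
  assume "\<not> ?thesis"
  then have "exp (- x) < exp (- K - 2)" "exp (- y) < exp (- K - 2)" "exp (- z) < exp (- K - 2)" by auto
  then have "exp (- x) + exp (- y) + exp (- z) < 3 * exp (- K - 2)" by linarith
  then have "exp K * (exp (- x) + exp (- y) + exp (- z)) < exp K * (3 * exp (- K - 2))"
    by (intro mult_strict_left_mono) auto
  also have "\<dots> = 3 / exp 2" by (simp add: exp_diff exp_minus)
  also have "\<dots> \<le> 1" using exp_ge_add_one_self[of 2] by simp
  finally show False using assms by simp
qed

text \<open>Absorbs the numerical constants of later estimates into one \<open>G\<close>: the
  constant is at most \<open>exp 98\<close>, and 98 plus the 2 lost for three summands is at most
  \<open>G\<close>.\<close>

lemma exp_sum3_bound':
  fixes C G K x y z :: real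
  assumes "1 \<le> C * exp K * (exp (- x) + exp (- y) + exp (- z))" "C \<le> 99" "100 \<le> G"
  shows "x \<le> K + G \<or> y \<le> K + G \<or> z \<le> K + G"
proof -
  have "C \<le> exp 98" using assms(2) exp_ge_add_one_self[of 98] by linarith
  then have "C * exp K * (exp (- x) + exp (- y) + exp (- z)) \<le> exp 98 * exp K * (exp (- x) + exp (- y) + exp (- z))"
    by (intro mult_right_mono) auto
  then have "1 \<le> exp (98 + K) * (exp (- x) + exp (- y) + exp (- z))"
    unfolding exp_add by (rule order_trans[OF assms(1)])
  from exp_sum3_bound[OF this] show ?thesis using assms(3) by linarith
qed

section \<open>Nonvanishing of the eliminated forms\<close>

text \<open>Both \<open>y ^ d - 1\<close> and \<open>y ^ e - 1\<close> contain the factor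
  \<open>y - 1\<close>. Cancelling it leaves geometric sums: the first is below
  \<open>2 ^ d\<close>, the second is at least \<open>y ^ (e - 1)\<close>.\<close>

lemma power_ratio_bound:
  fixes a y :: real
  assumes a: "a \<ge> 31" and y: "0 < y" "y \<le> 2" and de: "d > 0" "e > 0"
  shows "y ^ e * \<bar>y ^ d - 1\<bar> \<le> (a ^ d - 1) * \<bar>y ^ e - 1\<bar>"
proof -
  have "y ^ d - 1 = (y - 1) * (\<Sum>i<d. y ^ i)" by (rule power_diff_1_eq)
  then have "\<bar>y ^ d - 1\<bar> = \<bar>y - 1\<bar> * (\<Sum>i<d. y ^ i)" using y by (simp add: abs_mult sum_nonneg)
  also have "\<dots> \<le> \<bar>y - 1\<bar> * (\<Sum>i<d. 2 ^ i)" using y by (intro mult_left_mono sum_mono power_mono) auto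
  also have "(\<Sum>i<d. 2 ^ i) \<le> (2::real) ^ d" using power_diff_1_eq[of "2::real" d] by simp
  finally have 1: "\<bar>y ^ d - 1\<bar> \<le> \<bar>y - 1\<bar> * 2 ^ d" by (simp add: mult_left_mono)
  have "y ^ e - 1 = (y - 1) * (\<Sum>i<e. y ^ i)" by (rule power_diff_1_eq)
  then have "\<bar>y ^ e - 1\<bar> = \<bar>y - 1\<bar> * (\<Sum>i<e. y ^ i)" using y by (simp add: abs_mult sum_nonneg)
  moreover have "y ^ (e - 1) \<le> (\<Sum>i<e. y ^ i)" using de y by (intro member_le_sum) auto
  ultimately have 2: "\<bar>y - 1\<bar> * y ^ (e - 1) \<le> \<bar>y ^ e - 1\<bar>" by (simp add: mult_left_mono)
  have "y ^ e * \<bar>y ^ d - 1\<bar> \<le> y ^ e * (\<bar>y - 1\<bar> * 2 ^ d)" using 1 y by (intro mult_left_mono) auto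
  also have "\<dots> = (y * 2 ^ d) * (\<bar>y - 1\<bar> * y ^ (e - 1))" using de by (cases e) auto
  also have "\<dots> \<le> (2 * 2 ^ d) * \<bar>y ^ e - 1\<bar>" using 2 y by (intro mult_mono) auto
  also have "\<dots> \<le> (a ^ d - 1) * \<bar>y ^ e - 1\<bar>"
  proof (rule mult_right_mono)
    have "(31::real) ^ d \<le> a ^ d" using a by (intro power_mono) auto
    moreover have "(15::real) * 2 ^ d \<le> 15 ^ d * 2 ^ d"
      using de self_le_power[of "15::real" d] by (intro mult_right_mono) auto
    moreover have "(15::real) ^ d * 2 ^ d = 30 ^ d" by (simp flip: power_mult_distrib)
    moreover have "(30::real) ^ d \<le> 31 ^ d" by (intro power_mono) auto
    moreover have "(1::real) \<le> 2 ^ d" by simp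
    ultimately show "2 * 2 ^ d \<le> a ^ d - 1" by linarith
  qed auto
  finally show ?thesis .
qed

text \<open>With \<open>a = \<alpha>\<close> and \<open>x = \<beta>\<close> this says that
  \<open>a ^ e * (a ^ d - 1) / (a ^ e - 1)\<close> differs from its conjugate, hence is irrational.
  Mostly the left side wins in size. The delicate case is \<open>x\<close> negative and close to -1
  with \<open>e\<close> even and \<open>d\<close> odd, where \<open>x ^ e - 1\<close> may be tiny
  but \<open>x ^ d - 1\<close> is not.\<close>

lemma power_ratio_neq:
  fixes a x :: real
  assumes a: "a \<ge> 31" and x: "29 * \<bar>x\<bar> \<le> a" "\<bar>x\<bar> \<noteq> 1" "x \<noteq> 0"
    and small: "-1 < x \<Longrightarrow> x < 0 \<Longrightarrow> 2 \<le> (1 + a) * (1 + x)"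
    and de: "d > 0" "e > 0"
  shows "a ^ e * (a ^ d - 1) * (x ^ e - 1) \<noteq> x ^ e * (x ^ d - 1) * (a ^ e - 1)"
proof
  assume eq: "a ^ e * (a ^ d - 1) * (x ^ e - 1) = x ^ e * (x ^ d - 1) * (a ^ e - 1)"
  define y where "y = \<bar>x\<bar>"
  have y: "0 < y" "y \<noteq> 1" "29 * y \<le> a" using x by (auto simp: y_def)
  have ad: "a ^ k \<ge> 31" if "k > 0" for k :: nat
    using self_le_power[of a k] that a by linarith
  have xe: "x ^ e \<noteq> 1"
  proof
    assume "x ^ e = 1"
    then have "y ^ e = 1 ^ e" by (simp add: y_def flip: power_abs)
    then show False using y de by (metis less_eq_real_def power_eq_iff_eq_base zero_le_one)
  qed
  have tri: "\<bar>x ^ d - 1\<bar> \<le> y ^ d + 1" "y ^ e - 1 \<le> \<bar>x ^ e - 1\<bar>" "1 - y ^ e \<le> \<bar>x ^ e - 1\<bar>"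
    using abs_triangle_ineq4[of "x ^ d" 1] abs_triangle_ineq2[of "x ^ e" 1] abs_triangle_ineq2[of 1 "x ^ e"]
    by (auto simp: y_def power_abs abs_minus_commute)
  \<comment> \<open>Equality of the two sides would contradict this size comparison, because
    \<open>a ^ e - 1 < a ^ e\<close>. Each case but one below derives the excluded
    inequality.\<close>
  have bad: "\<not> y ^ e * \<bar>x ^ d - 1\<bar> \<le> (a ^ d - 1) * \<bar>x ^ e - 1\<bar>"
  proof
    assume le: "y ^ e * \<bar>x ^ d - 1\<bar> \<le> (a ^ d - 1) * \<bar>x ^ e - 1\<bar>"
    have "\<bar>x ^ e * (x ^ d - 1) * (a ^ e - 1)\<bar> = y ^ e * \<bar>x ^ d - 1\<bar> * (a ^ e - 1)"
      using ad[OF de(2)] by (simp add: abs_mult power_abs y_def)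
    also have "\<dots> \<le> (a ^ d - 1) * \<bar>x ^ e - 1\<bar> * (a ^ e - 1)"
      using le ad[OF de(2)] by (intro mult_right_mono) auto
    also have "\<dots> < (a ^ d - 1) * \<bar>x ^ e - 1\<bar> * a ^ e"
      using xe ad[OF de(1)] by (intro mult_strict_left_mono) auto
    also have "\<dots> = \<bar>a ^ e * (a ^ d - 1) * (x ^ e - 1)\<bar>"
      using ad[OF de(1)] ad[OF de(2)] by (simp add: abs_mult)
    finally show False using eq by simp
  qed
  consider "y \<ge> 2" | "y \<le> 1 / 2" | "1 / 2 < y" "y < 2" by linarith
  then show False
  proof cases
    case 1
    have "2 \<le> (2::real) ^ e" using de self_le_power[of "2::real" e] by simp
    then have ye: "2 \<le> y ^ e" using power_mono[of 2 y e] 1 by simp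
    have yd: "1 \<le> y ^ d" using 1 by simp
    have A: "y ^ e \<le> 2 * \<bar>x ^ e - 1\<bar>" "\<bar>x ^ d - 1\<bar> \<le> 2 * y ^ d"
      using tri(1,2) ye yd by argo+
    have "29 * y ^ d \<le> 29 ^ d * y ^ d" using de y self_le_power[of "29::real" d] by (intro mult_right_mono) auto
    also have "\<dots> = (29 * y) ^ d" by (simp add: power_mult_distrib)
    also have "\<dots> \<le> a ^ d" using y by (intro power_mono) auto
    finally have "4 * y ^ d \<le> a ^ d - 1" using \<open>1 \<le> y ^ d\<close> by linarith
    have "y ^ e * \<bar>x ^ d - 1\<bar> \<le> (2 * \<bar>x ^ e - 1\<bar>) * (2 * y ^ d)" using A y by (intro mult_mono) auto
    also have "\<dots> = (4 * y ^ d) * \<bar>x ^ e - 1\<bar>" by simp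
    also have "\<dots> \<le> (a ^ d - 1) * \<bar>x ^ e - 1\<bar>" by (rule mult_right_mono) (fact, simp)
    finally show False using bad by simp
  next
    case 2
    have "y ^ e \<le> y ^ 1" "y ^ d \<le> y ^ 1" using 2 y de by (intro power_decreasing; auto)+
    then have "y ^ e \<le> 1 / 2" "y ^ d \<le> 1 / 2" using 2 by auto
    then have "y ^ e \<le> \<bar>x ^ e - 1\<bar>" "\<bar>x ^ d - 1\<bar> \<le> a ^ d - 1" using tri ad[OF de(1)] by linarith+
    then have "y ^ e * \<bar>x ^ d - 1\<bar> \<le> \<bar>x ^ e - 1\<bar> * (a ^ d - 1)" by (intro mult_mono) auto
    then show False using bad by (simp add: mult.commute)
  next
    case 3
    have pos: "y ^ e * \<bar>y ^ d - 1\<bar> \<le> (a ^ d - 1) * \<bar>y ^ e - 1\<bar>" using power_ratio_bound[OF a y(1) _ de] 3 by simp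
    show False
    proof (cases "x > 0")
      case True
      then show False using pos bad by (simp add: y_def)
    next
      case False
      then have xy: "x = - y" by (simp add: y_def)
      show False
      proof (cases "even e")
        case True
        show False
        proof (cases "even d")
          case True
          then show False using pos bad \<open>even e\<close> by (simp add: xy)
        next
          case False
          show False
          \<comment> \<open>For \<open>y > 1\<close> the two sides have opposite signs; this case
            needs no size comparison.\<close>
          proof (cases "y > 1")
            case True
            have "a ^ e * (a ^ d - 1) * (x ^ e - 1) > 0"
              using ad[OF de(1)] ad[OF de(2)] True de \<open>even e\<close> by (simp add: xy one_less_power)
            moreover have "x ^ d = - (y ^ d)" using False by (simp add: xy)
            then have "x ^ d - 1 \<le> 0" using zero_le_power[OF less_imp_le[OF y(1)], of d] by linarith
            then have "x ^ e * (x ^ d - 1) \<le> 0" using \<open>even e\<close> by (intro mult_nonneg_nonpos) auto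
            then have "x ^ e * (x ^ d - 1) * (a ^ e - 1) \<le> 0"
              by (rule mult_nonpos_nonneg) (use ad[OF de(2)] in simp)
            ultimately show False using eq by linarith
          next
            case y1: False
            have e2: "e \<ge> 2" using \<open>even e\<close> de by (cases e; cases "e - 1") auto
            have "y ^ e \<le> y ^ 2" using e2 y y1 by (intro power_decreasing) auto
            have "y ^ d \<le> y ^ 1" using de y y1 by (intro power_decreasing) auto
            \<comment> \<open>The assumption \<open>small\<close> keeps \<open>y\<close> away from
              1: \<open>1 - y\<close> is at least \<open>2 / (1 + a)\<close>.\<close>
            have "2 \<le> (1 + a) * (1 - y)" using small y y1 x by (simp add: xy)
            then have "1 \<le> (a - 1) * (1 - y)"
            proof -
              have "(a + 1) * ((a - 1) * (1 - y)) = (a - 1) * ((1 + a) * (1 - y))" by (simp add: mult_ac)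
              also have "\<dots> \<ge> (a - 1) * 2" using \<open>2 \<le> (1 + a) * (1 - y)\<close> a by (intro mult_left_mono) auto
              finally have "(a - 1) * 2 \<le> (a + 1) * ((a - 1) * (1 - y))" .
              moreover have "(a + 1) * 1 \<le> (a - 1) * 2" using a by simp
              ultimately have "(a + 1) * 1 \<le> (a + 1) * ((a - 1) * (1 - y))" by (rule order_trans[rotated])
              then show ?thesis using a by (simp only: mult_le_cancel_left_pos)
            qed
            have "y ^ e * \<bar>x ^ d - 1\<bar> \<le> y ^ 2 * (1 + y)"
              using \<open>y ^ e \<le> y ^ 2\<close> \<open>y ^ d \<le> y ^ 1\<close> tri y by (intro mult_mono) auto
            also have "\<dots> \<le> 1 * (1 + y)" using y y1 by (intro mult_right_mono) (auto simp: power_le_one)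
            also have "\<dots> \<le> ((a - 1) * (1 - y)) * (1 + y)"
              using \<open>1 \<le> (a - 1) * (1 - y)\<close> y by (intro mult_right_mono) auto
            also have "\<dots> = (a - 1) * (1 - y ^ 2)" by (simp add: power2_eq_square algebra_simps)
            also have "\<dots> \<le> (a ^ d - 1) * \<bar>x ^ e - 1\<bar>"
            proof (rule mult_mono)
              show "1 - y ^ 2 \<le> \<bar>x ^ e - 1\<bar>" using tri(3) \<open>y ^ e \<le> y ^ 2\<close> by linarith
            qed (use self_le_power[of a d] a de y y1 in \<open>auto simp: power_le_one\<close>)
            finally show False using bad by simp
          qed
        qed
      next
        case False
        have "(2::real) ^ d \<le> 30 ^ d" by (intro power_mono) auto
        moreover have "y ^ d \<le> 2 ^ d" using 3 y by (intro power_mono) auto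
        moreover have "2 * 2 ^ d \<le> (31::real) ^ d"
        proof -
          have "(2::real) * 2 ^ d \<le> 15 ^ d * 2 ^ d" using de self_le_power[of "15::real" d] by (intro mult_right_mono) auto
          also have "\<dots> = 30 ^ d" by (simp flip: power_mult_distrib)
          also have "\<dots> \<le> 31 ^ d" by (intro power_mono) auto
          finally show ?thesis .
        qed
        moreover have "31 ^ d \<le> a ^ d" using a by (intro power_mono) auto
        moreover have "2 \<le> (2::real) ^ d" using de self_le_power[of "2::real" d] by simp
        ultimately have "y ^ d + 1 \<le> a ^ d - 1" by linarith
        then have "\<bar>x ^ d - 1\<bar> \<le> a ^ d - 1" using tri by linarith
        moreover have "y ^ e \<le> \<bar>x ^ e - 1\<bar>" using False y by (simp add: xy)
        ultimately have "y ^ e * \<bar>x ^ d - 1\<bar> \<le> \<bar>x ^ e - 1\<bar> * (a ^ d - 1)" by (intro mult_mono) auto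
        then show False using bad by (simp add: mult.commute)
      qed
    qed
  qed
qed

text \<open>Eliminating \<open>P\<close> and \<open>Z\<close> from two consecutive differences of solutions. Below, \<open>P = \<alpha>\<^sup>n\<close>, \<open>w = \<beta>\<^sup>n\<close>, \<open>Z = b\<^sup>m\<close>
  belong to the smallest solution, \<open>u, v\<close> are the powers of \<open>\<alpha>\<close> and \<open>s, t\<close> the powers of \<open>b\<close> given by the two gaps.\<close>

context
  fixes P Z w h u v s t u' v' :: real
  assumes P: "P > 0" and Z: "Z > 0" and uv: "1 \<le> u" "1 \<le> v" and st: "1 \<le> s" "1 \<le> t" "t \<le> 3 * v"
    and u'v': "\<bar>u'\<bar> \<le> u" "\<bar>v'\<bar> \<le> v"
    and e1: "P * u * (v - 1) + w * u' * (v' - 1) = Z * s * (t - 1)"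
    and e2: "P * (u - 1) + w * (u' - 1) = Z * (s - 1)"
begin

text \<open>Combining the relations crosswise cancels \<open>P\<close> and leaves only multiples of
  \<open>w\<close>, so the form carries the full factor \<open>h\<close>. The second factor on the
  left is the conjugate, estimated trivially.\<close>

lemma elim_both:
  assumes w: "\<bar>w\<bar> \<le> P * h" "0 \<le> h" and Zs: "9 * (P * u) \<le> 10 * (Z * s)"
  shows "\<bar>u * (v - 1) * (s - 1) - (u - 1) * (s * (t - 1))\<bar> *
    \<bar>u' * (v' - 1) * (s - 1) - (u' - 1) * (s * (t - 1))\<bar> \<le> 40 * (u * v * s) ^ 2 * h"
proof -
  have ab: "\<bar>u' - 1\<bar> \<le> 2 * u" "\<bar>v' - 1\<bar> \<le> 2 * v" using uv u'v' by linarith+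
  define f where "f = u * (v - 1) * (s - 1) - (u - 1) * (s * (t - 1))"
  have "Z * f = u * (v - 1) * (Z * (s - 1)) - (u - 1) * (Z * s * (t - 1))" by (simp add: f_def algebra_simps)
  also have "\<dots> = w * (u * (v - 1) * (u' - 1) - (u - 1) * u' * (v' - 1))"
    unfolding e1[symmetric] e2[symmetric] by (simp add: algebra_simps)
  also have "\<bar>\<dots>\<bar> \<le> (P * h) * (4 * u ^ 2 * v)"
    unfolding abs_mult[of w]
  proof (rule mult_mono[OF w(1)])
    have "\<bar>u * (v - 1) * (u' - 1)\<bar> \<le> u * v * (2 * u)"
      unfolding abs_mult using uv ab by (intro mult_mono) auto
    moreover have "\<bar>(u - 1) * u' * (v' - 1)\<bar> \<le> u * u * (2 * v)"
      unfolding abs_mult using uv ab u'v' by (intro mult_mono) auto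
    ultimately show "\<bar>u * (v - 1) * (u' - 1) - (u - 1) * u' * (v' - 1)\<bar> \<le> 4 * u ^ 2 * v"
      by (simp add: power2_eq_square algebra_simps)
  qed (use P w in auto)
  finally have "Z * \<bar>f\<bar> \<le> (P * h) * (4 * u ^ 2 * v)" using Z by (simp add: abs_mult)
  then have "s * (Z * \<bar>f\<bar>) \<le> s * ((P * h) * (4 * u ^ 2 * v))" using st by (intro mult_left_mono) auto
  also have "\<dots> = (P * u) * (4 * h * u * v * s)" by (simp add: power2_eq_square)
  finally have 1: "(Z * s) * \<bar>f\<bar> \<le> (P * u) * (4 * h * u * v * s)" by (simp add: mult_ac)
  have "9 * (P * u) * \<bar>f\<bar> \<le> 10 * (Z * s) * \<bar>f\<bar>" using Zs by (intro mult_right_mono) auto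
  with 1 have "9 * ((P * u) * \<bar>f\<bar>) \<le> 10 * ((P * u) * (4 * h * u * v * s))" by linarith
  then have "(P * u) * (9 * \<bar>f\<bar>) \<le> (P * u) * (40 * h * u * v * s)" by (simp add: mult_ac)
  then have "9 * \<bar>f\<bar> \<le> 40 * h * u * v * s" using P uv by (simp only: mult_le_cancel_left_pos mult_pos_pos)
  moreover have "0 \<le> h * u * v * s" using w uv st by simp
  ultimately have f: "\<bar>f\<bar> \<le> 5 * h * u * v * s" by (simp add: mult_ac)
  have "\<bar>u' * (v' - 1) * (s - 1)\<bar> \<le> u * (2 * v) * s"
    unfolding abs_mult using uv ab u'v' st by (intro mult_mono) auto
  moreover have "\<bar>(u' - 1) * (s * (t - 1))\<bar> \<le> (2 * u) * (s * (3 * v))"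
    unfolding abs_mult using uv ab u'v' st by (intro mult_mono) auto
  ultimately have f': "\<bar>u' * (v' - 1) * (s - 1) - (u' - 1) * (s * (t - 1))\<bar> \<le> 8 * u * v * s"
    by (simp add: algebra_simps)
  have "\<bar>f\<bar> * \<bar>u' * (v' - 1) * (s - 1) - (u' - 1) * (s * (t - 1))\<bar> \<le> (5 * h * u * v * s) * (8 * u * v * s)"
    using f f' w uv st by (intro mult_mono) auto
  also have "\<dots> = 40 * (u * v * s) ^ 2 * h" by (simp add: power2_eq_square)
  finally show ?thesis unfolding f_def .
qed

text \<open>For large \<open>s\<close>: the quotient \<open>s / (s - 1)\<close> is replaced by 1, so
  \<open>s\<close> leaves the form. The price is the remainder \<open>(t - 1) * Z\<close>, which is
  of relative size \<open>1 / s\<close>.\<close>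

lemma elim_left:
  assumes w: "\<bar>w\<bar> \<le> P * h" "0 \<le> h" and Zs: "Z * s \<le> 3 * (P * u)"
  shows "\<bar>u * (v - 1) - (t - 1) * (u - 1)\<bar> * \<bar>u' * (v' - 1) - (t - 1) * (u' - 1)\<bar> \<le> 80 * (u * v) ^ 2 * (1 / s + h)"
proof -
  have ab: "\<bar>u' - 1\<bar> \<le> 2 * u" "\<bar>v' - 1\<bar> \<le> 2 * v" using uv u'v' by linarith+
  define f where "f = u * (v - 1) - (t - 1) * (u - 1)"
  have "P * f = P * u * (v - 1) - (t - 1) * (P * (u - 1))" by (simp add: f_def algebra_simps)
  also have "P * u * (v - 1) = Z * s * (t - 1) - w * u' * (v' - 1)" using e1 by linarith
  also have "P * (u - 1) = Z * (s - 1) - w * (u' - 1)" using e2 by linarith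
  finally have "P * f = (t - 1) * Z + w * ((t - 1) * (u' - 1) - u' * (v' - 1))" by (simp add: algebra_simps)
  also have "\<bar>\<dots>\<bar> \<le> \<bar>(t - 1) * Z\<bar> + \<bar>w * ((t - 1) * (u' - 1) - u' * (v' - 1))\<bar>" by (rule abs_triangle_ineq)
  also have "\<dots> \<le> (3 * v) * (3 * (P * u) / s) + (P * h) * (8 * u * v)"
  proof (rule add_mono)
    have "Z \<le> 3 * (P * u) / s" using Zs st by (simp add: pos_le_divide_eq)
    then show "\<bar>(t - 1) * Z\<bar> \<le> (3 * v) * (3 * (P * u) / s)"
      unfolding abs_mult using st uv Z by (intro mult_mono) auto
    have "\<bar>(t - 1) * (u' - 1)\<bar> \<le> (3 * v) * (2 * u)"
      unfolding abs_mult using uv ab u'v' st by (intro mult_mono) auto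
    moreover have "\<bar>u' * (v' - 1)\<bar> \<le> u * (2 * v)"
      unfolding abs_mult using uv ab u'v' st by (intro mult_mono) auto
    ultimately have "\<bar>(t - 1) * (u' - 1) - u' * (v' - 1)\<bar> \<le> 8 * u * v" by (simp add: algebra_simps)
    then show "\<bar>w * ((t - 1) * (u' - 1) - u' * (v' - 1))\<bar> \<le> (P * h) * (8 * u * v)"
      unfolding abs_mult[of w] using w P by (intro mult_mono) auto
  qed
  also have "\<dots> = P * (u * v * (9 * (1 / s) + 8 * h))" by (simp add: algebra_simps)
  finally have "P * \<bar>f\<bar> \<le> P * (u * v * (9 * (1 / s) + 8 * h))" using P by (simp add: abs_mult)
  then have "\<bar>f\<bar> \<le> u * v * (9 * (1 / s) + 8 * h)" using P by (simp only: mult_le_cancel_left_pos)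
  also have "\<dots> \<le> u * v * (10 * (1 / s + h))"
  proof (rule mult_left_mono)
    have *: "9 * x + 8 * h \<le> 10 * (x + h)" if "0 \<le> x" for x using that w(2) by simp
    show "9 * (1 / s) + 8 * h \<le> 10 * (1 / s + h)" by (rule *) (use st in simp)
  qed (use uv in simp)
  finally have f: "\<bar>f\<bar> \<le> u * v * (10 * (1 / s + h))" .
  have "\<bar>u' * (v' - 1)\<bar> \<le> u * (2 * v)"
    unfolding abs_mult using uv ab u'v' st by (intro mult_mono) auto
  moreover have "\<bar>(t - 1) * (u' - 1)\<bar> \<le> (3 * v) * (2 * u)"
    unfolding abs_mult using uv ab u'v' st by (intro mult_mono) auto
  ultimately have f': "\<bar>u' * (v' - 1) - (t - 1) * (u' - 1)\<bar> \<le> 8 * (u * v)"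
    by (simp add: algebra_simps)
  have "\<bar>f\<bar> * \<bar>u' * (v' - 1) - (t - 1) * (u' - 1)\<bar> \<le> (u * v * (10 * (1 / s + h))) * (8 * (u * v))"
    using f f' w uv st by (intro mult_mono) auto
  also have "\<dots> = 80 * (u * v) ^ 2 * (1 / s + h)" by (simp add: power2_eq_square)
  finally show ?thesis unfolding f_def .
qed

text \<open>The counterpart for large \<open>u\<close>: now \<open>u / (u - 1)\<close> is replaced
  by 1, with remainder \<open>P * (v - 1)\<close> of relative size \<open>1 / u\<close>. Only
  \<open>v\<close> is then moved by conjugation.\<close>

lemma elim_right:
  assumes w: "\<bar>w\<bar> \<le> P" "\<bar>w * u'\<bar> \<le> P * u * h" "0 \<le> h" and Zs: "9 * (P * u) \<le> 10 * (Z * s)"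
  shows "\<bar>(s - 1) * (v - 1) - s * (t - 1)\<bar> * \<bar>(s - 1) * (v' - 1) - s * (t - 1)\<bar> \<le> 20 * (s * v) ^ 2 * (1 / u + h)"
proof -
  have ab: "\<bar>v' - 1\<bar> \<le> 2 * v" using uv u'v' by linarith
  define f where "f = (s - 1) * (v - 1) - s * (t - 1)"
  have "Z * f = Z * (s - 1) * (v - 1) - Z * s * (t - 1)" by (simp add: f_def algebra_simps)
  also have "\<dots> = - (P * (v - 1)) + (w * u' - w) * (v - 1) - w * u' * (v' - 1)"
    unfolding e1[symmetric] e2[symmetric] by (simp add: algebra_simps)
  also have "\<bar>\<dots>\<bar> \<le> \<bar>P * (v - 1)\<bar> + \<bar>(w * u' - w) * (v - 1)\<bar> + \<bar>w * u' * (v' - 1)\<bar>" by linarith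
  also have "\<dots> \<le> P * v + (P * u * h + P) * v + (P * u * h) * (2 * v)"
  proof (intro add_mono)
    show "\<bar>P * (v - 1)\<bar> \<le> P * v" unfolding abs_mult using P uv by (intro mult_mono) auto
    have "\<bar>w * u' - w\<bar> \<le> P * u * h + P" using w by linarith
    then show "\<bar>(w * u' - w) * (v - 1)\<bar> \<le> (P * u * h + P) * v"
      unfolding abs_mult[of "w * u' - w"] using P uv w by (intro mult_mono) auto
    show "\<bar>w * u' * (v' - 1)\<bar> \<le> (P * u * h) * (2 * v)"
      unfolding abs_mult[of "w * u'"] using P uv w ab by (intro mult_mono) auto
  qed
  also have "\<dots> = (P * u) * (v * (2 * (1 / u) + 3 * h))" using uv by (simp add: field_simps)
  finally have "Z * \<bar>f\<bar> \<le> (P * u) * (v * (2 * (1 / u) + 3 * h))" using Z by (simp add: abs_mult)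
  then have "s * (Z * \<bar>f\<bar>) \<le> s * ((P * u) * (v * (2 * (1 / u) + 3 * h)))" using st by (intro mult_left_mono) auto
  then have 1: "(Z * s) * \<bar>f\<bar> \<le> (P * u) * (s * v * (2 * (1 / u) + 3 * h))" by (simp only: mult_ac)
  have "9 * (P * u) * \<bar>f\<bar> \<le> 10 * (Z * s) * \<bar>f\<bar>" using Zs by (intro mult_right_mono) auto
  with 1 have "9 * ((P * u) * \<bar>f\<bar>) \<le> 10 * ((P * u) * (s * v * (2 * (1 / u) + 3 * h)))" by linarith
  then have "(P * u) * (9 * \<bar>f\<bar>) \<le> (P * u) * (10 * (s * v * (2 * (1 / u) + 3 * h)))" by (simp only: mult_ac)
  then have "9 * \<bar>f\<bar> \<le> 10 * (s * v * (2 * (1 / u) + 3 * h))"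
    using mult_pos_pos[of P u] P uv by (simp only: mult_le_cancel_left_pos)
  also have "\<dots> \<le> 10 * (s * v * ((36/10) * (1 / u + h)))"
  proof (intro mult_left_mono)
    have *: "2 * x + 3 * h \<le> (36/10) * (x + h)" if "0 \<le> x" for x using that w(3) by simp
    show "2 * (1 / u) + 3 * h \<le> (36/10) * (1 / u + h)" by (rule *) (use uv in simp)
  qed (use uv st in simp_all)
  also have "\<dots> = 9 * (4 * (s * v * (1 / u + h)))" by simp
  finally have f: "\<bar>f\<bar> \<le> 4 * (s * v * (1 / u + h))" by (simp only: mult_le_cancel_left_pos zero_less_numeral)
  have "\<bar>(s - 1) * (v' - 1)\<bar> \<le> s * (2 * v)"
    unfolding abs_mult using uv ab u'v' st by (intro mult_mono) auto
  moreover have "\<bar>s * (t - 1)\<bar> \<le> s * (3 * v)"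
    unfolding abs_mult using uv st by (intro mult_mono) auto
  ultimately have f': "\<bar>(s - 1) * (v' - 1) - s * (t - 1)\<bar> \<le> 5 * (s * v)"
    by (simp add: algebra_simps)
  have "\<bar>f\<bar> * \<bar>(s - 1) * (v' - 1) - s * (t - 1)\<bar> \<le> (4 * (s * v * (1 / u + h))) * (5 * (s * v))"
    using f f' w uv st by (intro mult_mono) auto
  also have "\<dots> = 20 * (s * v) ^ 2 * (1 / u + h)" by (simp add: power2_eq_square)
  finally show ?thesis unfolding f_def .
qed

end

section \<open>From separated logarithms to a bound for the largest exponent\<close>

context quad_pair begin

text \<open>Here \<open>sep\<close> is the bound for two logarithms. The form for the largest
  solution bounds \<open>k2 * a\<close> by \<open>2 * G\<close>; the form for the middle one bounds
  \<open>k1 * a\<close> or \<open>l1 * lb\<close> by \<open>2 * G\<close>. Then \<open>left\<close>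
  or \<open>right\<close> bounds the other by \<open>9 * G\<close>, and \<open>both\<close> bounds
  \<open>lam * n3\<close> by \<open>41 * G\<close>. Whenever an exponent is bounded instead of a
  gap, the argument stops early. The worst total is \<open>(41 + 9 + 2) * G\<close>.\<close>

lemma exponent_bound:
  fixes b :: int and n1 n2 n3 m1 m2 m3 :: nat and lam G c :: real
  assumes \<alpha>: "\<alpha> \<ge> 31" "29 * \<bar>\<beta>\<bar> \<le> \<alpha>" and small: "-1 < \<beta> \<Longrightarrow> \<beta> < 0 \<Longrightarrow> 2 \<le> (1 + \<alpha>) * (1 + \<beta>)"
    and b: "b \<ge> 2" and lam: "0 < lam" "lam \<le> ln \<alpha>" "\<bar>\<beta>\<bar> \<le> \<alpha> * exp (- lam)" and G: "G \<ge> 100"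
    and sep: "\<And>n m. 0 < n \<Longrightarrow> n \<le> n1 \<Longrightarrow> exp (- G) \<le> \<bar>real n * ln \<alpha> - real m * ln (of_int b)\<bar>"
    and ord: "n3 < n2" "n2 < n1" "2 \<le> n3"
    and eq: "\<alpha> ^ n1 + \<beta> ^ n1 - of_int b ^ m1 = c" "\<alpha> ^ n2 + \<beta> ^ n2 - of_int b ^ m2 = c"
      "\<alpha> ^ n3 + \<beta> ^ n3 - of_int b ^ m3 = c"
  shows "lam * n1 \<le> 100 * G"
proof -
  define r where "r = real_of_int b"
  define a where "a = ln \<alpha>"
  define lb where "lb = ln r"
  define k1 where "k1 = n2 - n3"
  define k2 where "k2 = n1 - n2"
  have k: "k1 > 0" "k2 > 0" "n2 = n3 + k1" "n1 = n3 + k1 + k2" using ord by (auto simp: k1_def k2_def)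
  have r2: "r \<ge> 2" using b by (simp add: r_def)
  have a3: "a > 0" using \<alpha> by (simp add: a_def)
  define P where "P = \<alpha> ^ n3"
  define u where "u = \<alpha> ^ k1"
  define v where "v = \<alpha> ^ k2"
  define w where "w = \<beta> ^ n3"
  define u' where "u' = \<beta> ^ k1"
  define v' where "v' = \<beta> ^ k2"
  have expa: "\<alpha> ^ i = exp (i * a)" for i using \<alpha> by (simp add: a_def exp_of_nat_mult)
  have expr: "r ^ i = exp (i * lb)" for i using r2 by (simp add: lb_def exp_of_nat_mult)
  have pw: "\<alpha> ^ n2 = P * u" "\<alpha> ^ n1 = P * u * v" "\<beta> ^ n2 = w * u'" "\<beta> ^ n1 = w * u' * v'"
    by (simp_all add: k P_def u_def v_def w_def u'_def v'_def power_add)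
  have u31: "31 \<le> u" "31 \<le> v" using self_le_power[of \<alpha> k1] self_le_power[of \<alpha> k2] \<alpha> k
    by (auto simp: u_def v_def)
  have P0: "P > 0" using \<alpha> by (simp add: P_def)
  have \<beta>\<alpha>: "\<bar>\<beta>\<bar> \<le> \<alpha>" using \<alpha> by linarith
  have u'u: "\<bar>u'\<bar> \<le> u" "\<bar>v'\<bar> \<le> v" using \<beta>\<alpha> by (auto simp: u'_def u_def v'_def v_def power_abs intro!: power_mono)
  have bexp: "\<bar>\<beta> ^ i\<bar> \<le> \<alpha> ^ i * exp (- (lam * i))" for i
  proof -
    have "\<bar>\<beta>\<bar> ^ i \<le> (\<alpha> * exp (- lam)) ^ i" using lam by (intro power_mono) auto
    also have "\<dots> = \<alpha> ^ i * exp (- (lam * i))" by (simp add: power_mult_distrib exp_of_nat_mult[symmetric] mult.commute)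
    finally show ?thesis by (simp add: power_abs)
  qed
  \<comment> \<open>This is where \<open>n3 \<ge> 2\<close> enters, through
    \<open>29 ^ 2 = 841\<close>.\<close>
  have w800: "800 * \<bar>w\<bar> \<le> P"
  proof -
    have "800 \<le> (29::real) ^ 2" by simp
    also have "\<dots> \<le> 29 ^ n3" using ord by (intro power_increasing) auto
    finally have "800 * \<bar>\<beta>\<bar> ^ n3 \<le> 29 ^ n3 * \<bar>\<beta>\<bar> ^ n3" by (intro mult_right_mono) auto
    also have "\<dots> = (29 * \<bar>\<beta>\<bar>) ^ n3" by (simp add: power_mult_distrib)
    also have "\<dots> \<le> \<alpha> ^ n3" using \<alpha> by (intro power_mono) auto
    finally show ?thesis by (simp add: w_def P_def power_abs)
  qed
  have wu800: "800 * \<bar>w * u'\<bar> \<le> P * u"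
    using mult_mono[OF w800 u'u(1)] P0 by (simp add: abs_mult)
  have wuv800: "800 * \<bar>w * u' * v'\<bar> \<le> P * u * v"
    using mult_mono[OF wu800 u'u(2)] P0 u31 by (simp add: abs_mult)
  define Q2 where "Q2 = P * u"
  define Q1 where "Q1 = P * u * v"
  have Q: "31 * P \<le> Q2" "31 * Q2 \<le> Q1" "Q2 > 0" "Q1 > 0"
    using mult_left_mono[OF u31(1), of P] mult_left_mono[OF u31(2), of "P * u"] P0 u31
    by (auto simp: Q1_def Q2_def mult.commute)
  define Z where "Z = r ^ m3"
  define Z2 where "Z2 = r ^ m2"
  define Z1 where "Z1 = r ^ m1"
  have Zpos: "Z > 0" "Z2 > 0" "Z1 > 0" using r2 by (auto simp: Z_def Z2_def Z1_def)
  have E3: "Q2 + w * u' - (P + w) = Z2 - Z"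
    using eq(2,3) pw by (simp add: Z2_def Z_def Q2_def r_def P_def w_def)
  have E2: "Q1 + w * u' * v' - (Q2 + w * u') = Z1 - Z2"
    using eq(1,2) pw by (simp add: Z2_def Z1_def Q1_def Q2_def r_def)
  have wQ: "800 * \<bar>w * u'\<bar> \<le> Q2" "800 * \<bar>w * u' * v'\<bar> \<le> Q1"
    using wu800 wuv800 by (auto simp: Q2_def Q1_def)
  have "Z < Z2" using E3 Q w800 wQ P0 by linarith
  then have m32: "m3 < m2" using r2 by (auto simp: Z_def Z2_def)
  have "Z2 < Z1" using E2 Q wQ by linarith
  then have m21: "m2 < m1" using r2 by (auto simp: Z1_def Z2_def)
  define l1 where "l1 = m2 - m3"
  define l2 where "l2 = m1 - m2"
  define s where "s = r ^ l1"
  define t where "t = r ^ l2"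
  have st: "2 \<le> s" "2 \<le> t" using self_le_power[of r l1] self_le_power[of r l2] r2 m32 m21
    by (auto simp: s_def t_def l1_def l2_def)
  have Zs: "Z2 = Z * s" "Z1 = Z2 * t"
    using m32 m21 by (simp_all add: Z_def Z1_def Z2_def s_def t_def l1_def l2_def flip: power_add)
  have Z2Z: "2 * Z \<le> Z2" "2 * Z2 \<le> Z1"
    using mult_left_mono[OF st(1), of Z] mult_left_mono[OF st(2), of Z2] Zpos by (auto simp: Zs(1) Zs(2) mult.commute)
  \<comment> \<open>\<open>Z2 - Z\<close> differs from \<open>Q2\<close> only by \<open>P\<close>
    and powers of \<open>\<beta>\<close>, and \<open>Z\<close> is at most \<open>Z2 / 2\<close>
    because \<open>r \<ge> 2\<close>.\<close>
  have Z2b: "9 * Q2 \<le> 10 * Z2" "100 * Z2 \<le> 203 * Q2" using E3 Q w800 wQ(1) Z2Z(1) Zpos P0 by linarith+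
  have Z1b: "100 * Z1 \<le> 203 * Q1" using E2 Q wQ Z2Z(2) Zpos by linarith
  have t3: "t \<le> 3 * v"
  proof -
    have "100 * (Z2 * t) \<le> 203 * (Q2 * v)" using Z1b by (simp add: Zs(2) Q1_def Q2_def)
    also have "Q2 * v \<le> (10 / 9 * Z2) * v" using Z2b u31 by (intro mult_right_mono) auto
    finally have "100 * (Z2 * t) \<le> 203 * ((10 / 9 * Z2) * v)" by simp
    moreover have "0 \<le> Z2 * v" using Zpos u31 by simp
    ultimately have "Z2 * t \<le> Z2 * (3 * v)" by simp
    then show ?thesis using Zpos by simp
  qed
  have lnQ: "ln Q1 = n1 * a" "ln Q2 = n2 * a" using expa[of n1] expa[of n2] pw by (simp_all add: Q1_def Q2_def)
  have lnZ: "ln Z1 = m1 * lb" "ln Z2 = m2 * lb" by (simp_all add: Z1_def Z2_def expr)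
  have sepQ: "exp (- G) \<le> \<bar>ln Q1 - ln Z1\<bar>" "exp (- G) \<le> \<bar>ln Q2 - ln Z2\<bar>"
    using sep[of n1 m1] sep[of n2 m2] ord unfolding lnQ lnZ a_def lb_def r_def by auto
  have eG: "exp (- G) \<le> 1" using G by simp
  have iu: "1 / u = exp (- (k1 * a))" "1 / v = exp (- (k2 * a))" "1 / s = exp (- (l1 * lb))"
    by (simp_all add: u_def v_def s_def expa expr exp_minus inverse_eq_divide)
  have step1: "lam * n1 \<le> 2 * G \<or> k2 * a \<le> 2 * G"
  proof -
    define d where "d = exp (- (lam * n1)) + 2 * exp (- (k2 * a))"
    have "Q1 - Z1 = Q2 + w * u' - Z2 - w * u' * v'" using E2 by linarith
    then have "\<bar>Q1 - Z1\<bar> \<le> \<bar>w * u' * v'\<bar> + 2 * Q2" using Z2b Zpos wQ(1) Q by linarith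
    moreover have "\<bar>w * u' * v'\<bar> \<le> Q1 * exp (- (lam * n1))" using bexp[of n1] by (simp add: pw Q1_def)
    moreover have "Q2 = Q1 * exp (- (k2 * a))" unfolding iu[symmetric] using u31 by (simp add: Q1_def Q2_def)
    ultimately have "\<bar>Q1 - Z1\<bar> \<le> d * Q1" by (simp add: d_def algebra_simps)
    \<comment> \<open>The logarithmic comparison needs \<open>d \<le> 1 / 2\<close>; for larger
      \<open>d\<close> the bound follows from \<open>exp (- G) \<le> 1\<close>.\<close>
    then have "exp (- G) \<le> 2 * d" if "d \<le> 1 / 2"
      using abs_ln_diff_le[of Q1 Z1 d] sepQ(1) Q Zpos that by linarith
    then have "exp (- G) \<le> 2 * d" using eG by linarith
    also have "\<dots> \<le> 2 * (exp (- (lam * n1)) + exp (- (k2 * a)) + exp (- (k2 * a)))" by (simp add: d_def)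
    finally have "exp G * exp (- G) \<le> exp G * (2 * (exp (- (lam * n1)) + exp (- (k2 * a)) + exp (- (k2 * a))))"
      by (rule mult_left_mono) simp
    then have "1 \<le> 2 * exp G * (exp (- (lam * n1)) + exp (- (k2 * a)) + exp (- (k2 * a)))"
      by (simp add: exp_minus mult_ac)
    from exp_sum3_bound'[OF this _ G] show ?thesis by simp
  qed
  have step2: "lam * n2 \<le> 2 * G \<or> k1 * a \<le> 2 * G \<or> l1 * lb \<le> 2 * G"
  proof -
    define d where "d = exp (- (lam * n2)) + 3 * exp (- (k1 * a)) + 3 * exp (- (l1 * lb))"
    have "Q2 - Z2 = P + w - Z - w * u'" using E3 by linarith
    then have "\<bar>Q2 - Z2\<bar> \<le> \<bar>w * u'\<bar> + 3 * P + Z" using Zpos w800 P0 by linarith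
    moreover have "\<bar>w * u'\<bar> \<le> Q2 * exp (- (lam * n2))" using bexp[of n2] by (simp add: pw Q2_def)
    moreover have "P = Q2 * exp (- (k1 * a))" unfolding iu[symmetric] using u31 by (simp add: Q2_def)
    moreover have "Z \<le> 3 * Q2 * exp (- (l1 * lb))"
      unfolding iu[symmetric] using st Z2b Q by (simp add: pos_le_divide_eq Zs)
    ultimately have "\<bar>Q2 - Z2\<bar> \<le> d * Q2" by (simp add: d_def algebra_simps)
    then have "exp (- G) \<le> 2 * d" if "d \<le> 1 / 2"
      using abs_ln_diff_le[of Q2 Z2 d] sepQ(2) Q Zpos that by linarith
    then have "exp (- G) \<le> 2 * d" using eG by linarith
    also have "\<dots> \<le> 6 * (exp (- (lam * n2)) + exp (- (k1 * a)) + exp (- (l1 * lb)))" by (simp add: d_def)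
    finally have "exp G * exp (- G) \<le> exp G * (6 * (exp (- (lam * n2)) + exp (- (k1 * a)) + exp (- (l1 * lb))))"
      by (rule mult_left_mono) simp
    then have "1 \<le> 6 * exp G * (exp (- (lam * n2)) + exp (- (k1 * a)) + exp (- (l1 * lb)))"
      by (simp add: exp_minus mult_ac)
    from exp_sum3_bound'[OF this _ G] show ?thesis by simp
  qed
  have lk: "lam * real i \<le> i * a" for i using mult_right_mono[OF lam(2), of "real i"] by (simp add: a_def mult.commute)
  have ln12: "lam * n1 = lam * n2 + lam * k2" "lam * n2 = lam * n3 + lam * k1" by (simp_all add: k algebra_simps)
  have e1: "P * u * (v - 1) + w * u' * (v' - 1) = Z * s * (t - 1)"
    using E2 by (simp add: Q1_def Q2_def Zs algebra_simps)
  have e2: "P * (u - 1) + w * (u' - 1) = Z * (s - 1)"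
    using E3 by (simp add: Q2_def Zs algebra_simps)
  have uv1: "1 \<le> u" "1 \<le> v" and st1: "1 \<le> s" "1 \<le> t" using u31 st by auto
  note elim = P0 Zpos(1) uv1 st1 t3 u'u e1 e2
  have Zs9: "9 * (P * u) \<le> 10 * (Z * s)" and Zs3: "Z * s \<le> 3 * (P * u)"
    using Z2b Q by (auto simp: Q2_def Zs)
  have wh: "\<bar>w\<bar> \<le> P * exp (- (lam * n3))" using bexp[of n3] by (simp add: w_def P_def)
  have wh2: "\<bar>w\<bar> \<le> P" "\<bar>w * u'\<bar> \<le> P * u * exp (- (lam * n2))" using w800 bexp[of n2] by (auto simp: pw)
  have cu: "conj_pair u u'" and cv: "conj_pair v v'" by (auto simp: u_def u'_def v_def v'_def)
  have cs: "conj_pair s s" and ct: "conj_pair t t"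
    unfolding s_def t_def r_def using conj_pair_of_int[of b] by blast+
  have \<beta>irr: "\<bar>\<beta>\<bar> \<noteq> 1" "\<beta> \<noteq> 0" using irrational_conj by (auto simp: abs_if split: if_splits)
  \<comment> \<open>If the form in \<open>left\<close> or \<open>both\<close> vanished,
    \<open>u * (v - 1) / (u - 1)\<close> would be rational and so equal to its conjugate.\<close>
  have neq: "u * (v - 1) * (u' - 1) \<noteq> u' * (v' - 1) * (u - 1)"
    unfolding u_def v_def u'_def v'_def by (rule power_ratio_neq[OF \<alpha> \<beta>irr small k(2,1)])
  have uvG: "(u * v) ^ 2 \<le> exp (8 * G)" if "k1 * a \<le> 2 * G" "k2 * a \<le> 2 * G"
  proof -
    have "(u * v) ^ 2 = exp (2 * (k1 * a + k2 * a))" by (simp add: u_def v_def expa power2_eq_square flip: exp_add)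
    then show ?thesis using that by simp
  qed
  have svG: "(s * v) ^ 2 \<le> exp (8 * G)" if "l1 * lb \<le> 2 * G" "k2 * a \<le> 2 * G"
  proof -
    have "(s * v) ^ 2 = exp (2 * (l1 * lb + k2 * a))" by (simp add: s_def v_def expa expr power2_eq_square flip: exp_add)
    then show ?thesis using that by simp
  qed
  have left: "l1 * lb \<le> 9 * G \<or> lam * n3 \<le> 9 * G" if kG: "k1 * a \<le> 2 * G" "k2 * a \<le> 2 * G"
  proof -
    have cp: "conj_pair (u * (v - 1) - (t - 1) * (u - 1)) (u' * (v' - 1) - (t - 1) * (u' - 1))"
      using cu cv ct by blast
    have nz: "u * (v - 1) - (t - 1) * (u - 1) \<noteq> 0"
    proof
      assume z: "u * (v - 1) - (t - 1) * (u - 1) = 0"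
      then have z': "u' * (v' - 1) - (t - 1) * (u' - 1) = 0" using conj_pair_eq_0_iff[OF cp] by simp
      have "u * (v - 1) * (u' - 1) = (t - 1) * (u - 1) * (u' - 1)" using z by simp
      also have "\<dots> = u' * (v' - 1) * (u - 1)" using z' by simp
      finally show False using neq by simp
    qed
    have "1 \<le> 80 * (u * v) ^ 2 * (1 / s + exp (- (lam * n3)))"
      by (rule order_trans[OF conj_pair_norm_ge_1[OF cp nz]])
         (rule elim_left[OF elim wh _ Zs3], simp)
    also have "\<dots> \<le> 80 * exp (8 * G) * (exp (- (l1 * lb)) + exp (- (lam * n3)) + exp (- (lam * n3)))"
      unfolding iu using uvG[OF kG] by (intro mult_mono) auto
    finally show ?thesis using exp_sum3_bound'[OF _ _ G] by fastforce
  qed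
  have right: "k1 * a \<le> 9 * G \<or> lam * n2 \<le> 9 * G" if kG: "l1 * lb \<le> 2 * G" "k2 * a \<le> 2 * G"
  proof -
    have cp: "conj_pair ((s - 1) * (v - 1) - s * (t - 1)) ((s - 1) * (v' - 1) - s * (t - 1))"
      using cs cv ct by blast
    \<comment> \<open>The terms with \<open>s\<close> and \<open>t\<close> are rational integers, so
      subtracting the conjugate equation leaves \<open>v = v'\<close>, contrary to the dominance of
      \<open>\<alpha>\<close>.\<close>
    have nz: "(s - 1) * (v - 1) - s * (t - 1) \<noteq> 0"
    proof
      assume z: "(s - 1) * (v - 1) - s * (t - 1) = 0"
      then have "(s - 1) * (v' - 1) - s * (t - 1) = 0" using conj_pair_eq_0_iff[OF cp] by simp
      with z have "(s - 1) * (v - 1) = (s - 1) * (v' - 1)" by linarith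
      then have "v = v'" using st by simp
      moreover have "\<bar>\<beta>\<bar> ^ k2 < \<alpha> ^ k2" using \<alpha> k by (intro power_strict_mono) auto
      ultimately show False by (simp add: v_def v'_def flip: power_abs)
    qed
    have "1 \<le> 20 * (s * v) ^ 2 * (1 / u + exp (- (lam * n2)))"
      by (rule order_trans[OF conj_pair_norm_ge_1[OF cp nz]])
         (rule elim_right[OF elim wh2 _ Zs9], simp)
    also have "\<dots> \<le> 20 * exp (8 * G) * (exp (- (k1 * a)) + exp (- (lam * n2)) + exp (- (lam * n2)))"
      unfolding iu using svG[OF kG] by (intro mult_mono) auto
    finally show ?thesis using exp_sum3_bound'[OF _ _ G] by fastforce
  qed
  have both: "lam * n3 \<le> 41 * G" if kG: "k1 * a \<le> 9 * G" "l1 * lb \<le> 9 * G" "k2 * a \<le> 2 * G"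
  proof -
    have cp: "conj_pair (u * (v - 1) * (s - 1) - (u - 1) * (s * (t - 1))) (u' * (v' - 1) * (s - 1) - (u' - 1) * (s * (t - 1)))"
      using cu cv cs ct by (intro conj_pair_diff conj_pair_mult conj_pair_1)
    have nz: "u * (v - 1) * (s - 1) - (u - 1) * (s * (t - 1)) \<noteq> 0"
    proof
      assume z: "u * (v - 1) * (s - 1) - (u - 1) * (s * (t - 1)) = 0"
      then have z': "u' * (v' - 1) * (s - 1) - (u' - 1) * (s * (t - 1)) = 0" using conj_pair_eq_0_iff[OF cp] by simp
      have "u * (v - 1) * (u' - 1) * (s - 1) = (u * (v - 1) * (s - 1)) * (u' - 1)" by (simp add: mult_ac)
      also have "\<dots> = ((u - 1) * (s * (t - 1))) * (u' - 1)" using z by simp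
      also have "\<dots> = ((u' - 1) * (s * (t - 1))) * (u - 1)" by (simp add: mult_ac)
      also have "\<dots> = (u' * (v' - 1) * (s - 1)) * (u - 1)" using z' by simp
      also have "\<dots> = u' * (v' - 1) * (u - 1) * (s - 1)" by (simp add: mult_ac)
      finally show False using neq st by simp
    qed
    have "(u * v * s) ^ 2 = exp (2 * (k1 * a + k2 * a + l1 * lb))"
      by (simp add: u_def v_def s_def expa expr power2_eq_square flip: exp_add)
    \<comment> \<open>The exponent is twice the sum of the three gap bounds:
      \<open>2 * (9 + 2 + 9) = 40\<close>.\<close>
    then have uvs: "(u * v * s) ^ 2 \<le> exp (40 * G)" using kG by simp
    have "1 \<le> 40 * (u * v * s) ^ 2 * exp (- (lam * n3))"
      by (rule order_trans[OF conj_pair_norm_ge_1[OF cp nz]])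
         (rule elim_both[OF elim wh _ Zs9], simp)
    also have "\<dots> \<le> 40 * exp (40 * G) * (exp (- (lam * n3)) + exp (- (lam * n3)) + exp (- (lam * n3)))"
      using uvs by (intro mult_mono) auto
    finally show ?thesis using exp_sum3_bound'[OF _ _ G] by fastforce
  qed
  show ?thesis
    using step1 step2 left right both lk[of k1] lk[of k2] ln12 G by argo
qed

end

section \<open>Explicit constants\<close>

text \<open>The bounds on \<open>B\<close> and \<open>A\<close> make
  \<open>\<bar>\<beta>\<bar> / \<alpha>\<close> at most \<open>\<alpha>\<close> to the power
  \<open>- \<epsilon> / 4\<close>. With \<open>L\<close> of order \<open>ln n1\<close>, the previous
  bound becomes \<open>\<epsilon> * n1\<close> at most a constant times
  \<open>lb * (ln n1) ^ 2\<close>, which solves to a multiple of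
  \<open>lb ^ 2 / \<epsilon> ^ 2\<close> below \<open>C1\<close>.\<close>

lemma lucas_bound:
  fixes \<epsilon> \<alpha> \<beta> c :: real and A B b :: int and n1 n2 n3 m1 m2 m3 :: nat
  assumes eps: "0 < \<epsilon>" "\<epsilon> < 1" and A0: "A > 0" and gcd: "gcd A B = 1"
    and sum: "\<alpha> + \<beta> = of_int A" and prod: "\<alpha> * \<beta> = of_int B" and irr: "\<alpha> \<notin> \<rat>"
    and dom: "\<bar>\<beta>\<bar> < \<alpha>" and B: "\<bar>of_int B\<bar> < (of_int A :: real) powr (2 - \<epsilon>)"
    and A32: "(32 :: real) powr (1 / \<epsilon>) \<le> of_int A" and b: "b \<ge> 2"
    and ord: "n3 < n2" "n2 < n1" "2 \<le> n3"
    and eq: "\<alpha> ^ n1 + \<beta> ^ n1 - of_int b ^ m1 = c" "\<alpha> ^ n2 + \<beta> ^ n2 - of_int b ^ m2 = c"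
      "\<alpha> ^ n3 + \<beta> ^ n3 - of_int b ^ m3 = c"
  shows "real n1 < C1 \<epsilon> b"
proof (rule ccontr)
  assume "\<not> ?thesis"
  then have big: "C1 \<epsilon> b \<le> real n1" by simp
  interpret quad_pair \<alpha> \<beta> A B by unfold_locales fact+
  define x where "x = real_of_int A"
  define lb where "lb = ln (real_of_int b)"
  define a where "a = ln \<alpha>"
  have x0: "x > 0" using A0 by (simp add: x_def)
  have "(32::real) powr 1 < 32 powr (1 / \<epsilon>)" using eps by (intro powr_less_mono) auto
  then have "x > 32" using A32 by (simp add: x_def)
  then have "A \<ge> 33" by (simp add: x_def)
  then have x33: "x \<ge> 33" by (simp add: x_def)
  \<comment> \<open>Half of the gain \<open>x powr \<epsilon>\<close>: of the two factors
    \<open>Y\<close>, one supplies the decay rate and the other, being at least 5, absorbs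
    constants.\<close>
  define Y where "Y = x powr (\<epsilon> / 2)"
  have Y2: "Y * Y = x powr \<epsilon>" by (simp add: Y_def flip: powr_add)
  have "((32::real) powr (1 / \<epsilon>)) powr \<epsilon> \<le> x powr \<epsilon>" using A32 eps x0 by (intro powr_mono2) (auto simp: x_def)
  then have Y32: "32 \<le> Y * Y" using eps by (simp add: powr_powr Y2)
  have Y0: "Y > 0" using x0 by (simp add: Y_def)
  have Y5: "5 \<le> Y"
  proof (rule ccontr)
    assume "\<not> ?thesis"
    then have "Y * Y \<le> 5 * 5" using Y0 by (intro mult_mono) auto
    then show False using Y32 by simp
  qed
  have "x powr (2 - \<epsilon>) = x ^ 2 / (Y * Y)" using x0 by (simp add: Y2 powr_diff)
  then have absB: "\<bar>\<alpha> * \<beta>\<bar> * (Y * Y) < x ^ 2" using B Y0 by (simp add: prod x_def pos_less_divide_eq)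
  have \<alpha>0: "\<alpha> > 0" using dom by linarith
  have "\<alpha> * \<bar>\<beta>\<bar> * 32 \<le> \<alpha> * \<bar>\<beta>\<bar> * (Y * Y)" using Y32 \<alpha>0 by (intro mult_left_mono) auto
  also have "\<dots> < x ^ 2" using absB \<alpha>0 by (simp add: abs_mult)
  finally have ab32: "32 * (\<alpha> * \<bar>\<beta>\<bar>) < x ^ 2" by (simp add: mult.commute)
  have \<alpha>2: "2 * \<alpha> > x" "\<alpha> \<le> x + \<bar>\<beta>\<bar>" "x - \<bar>\<beta>\<bar> \<le> \<alpha>" using sum dom unfolding x_def by linarith+
  \<comment> \<open>A bootstrap: \<open>\<alpha> > x / 2\<close> gives this bound on
    \<open>\<beta>\<close>, hence \<open>\<alpha> \<ge> 15 * x / 16\<close>, which in turn improves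
    the bound to \<open>x / 30\<close>.\<close>
  have "16 * \<bar>\<beta>\<bar> \<le> x"
  proof (rule ccontr)
    assume "\<not> ?thesis"
    then have "x * x \<le> (2 * \<alpha>) * (16 * \<bar>\<beta>\<bar>)" using \<alpha>2 x0 by (intro mult_mono) auto
    then show False using ab32 by (simp add: power2_eq_square)
  qed
  then have \<alpha>16: "15 * x \<le> 16 * \<alpha>" using \<alpha>2 by linarith
  have \<beta>30: "30 * \<bar>\<beta>\<bar> \<le> x"
  proof -
    have "(15 * x) * (2 * \<bar>\<beta>\<bar>) \<le> (16 * \<alpha>) * (2 * \<bar>\<beta>\<bar>)" using \<alpha>16 by (intro mult_right_mono) auto
    also have "\<dots> \<le> x * x" using ab32 by (simp add: power2_eq_square)
    finally have "x * (30 * \<bar>\<beta>\<bar>) \<le> x * x" by simp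
    then show ?thesis using x0 by simp
  qed
  have \<alpha>29: "29 * x \<le> 30 * \<alpha>" "30 * \<alpha> \<le> 31 * x" using \<beta>30 \<alpha>2 by linarith+
  then have \<alpha>31: "31 \<le> \<alpha>" "29 * \<bar>\<beta>\<bar> \<le> \<alpha>" using x33 \<beta>30 by linarith+
  have a3: "3 \<le> a"
  proof -
    have "exp 3 = exp 1 * exp 1 * exp (1::real)" by (simp flip: exp_add)
    also have "\<dots> \<le> 3 * 3 * 3" using exp_le by (intro mult_mono) auto
    finally have "exp 3 \<le> \<alpha>" using \<alpha>31 by simp
    then show ?thesis using \<alpha>0 by (simp add: a_def ln_ge_iff)
  qed
  have lb: "lb \<ge> 1 / 2" unfolding lb_def using b by (intro ln_ge_half) simp
  \<comment> \<open>Since \<open>\<alpha> \<le> x ^ 2\<close>, this rate satisfies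
    \<open>exp lam \<le> Y\<close>.\<close>
  define lam where "lam = \<epsilon> * a / 4"
  have lam: "0 < lam" "lam \<le> a"
    using eps a3 mult_right_mono[of \<epsilon> 1 a] by (auto simp: lam_def)
  have \<beta>lam: "\<bar>\<beta>\<bar> \<le> \<alpha> * exp (- lam)"
  proof -
    have "2 * x \<le> x * x" using x33 by (intro mult_right_mono) auto
    then have "\<alpha> \<le> x * x" using \<alpha>29 x0 by linarith
    then have "a \<le> 2 * ln x" unfolding a_def using \<alpha>0 x0 by (metis ln_le_cancel_iff ln_mult mult_2 mult_pos_pos order_less_irrefl)
    then have "\<epsilon> * a \<le> \<epsilon> * (2 * ln x)" using eps by (intro mult_left_mono) auto
    then have "lam \<le> \<epsilon> / 2 * ln x" by (simp add: lam_def)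
    then have "exp lam \<le> Y" using x0 by (simp add: Y_def powr_def)
    moreover have "\<bar>\<beta>\<bar> * Y \<le> \<alpha>"
    proof -
      have "\<alpha> * \<bar>\<beta>\<bar> * (Y * 5) \<le> \<alpha> * \<bar>\<beta>\<bar> * (Y * Y)" using Y5 Y0 \<alpha>0 by (intro mult_left_mono) auto
      also have "\<dots> \<le> x * x" using absB \<alpha>0 by (simp add: abs_mult power2_eq_square)
      also have "\<dots> \<le> (2 * \<alpha>) * (2 * \<alpha>)" using \<alpha>2 x0 by (intro mult_mono) auto
      finally have "\<alpha> * (5 * (\<bar>\<beta>\<bar> * Y)) \<le> \<alpha> * (4 * \<alpha>)" by simp
      then show ?thesis using \<alpha>0 by simp
    qed
    ultimately have "\<bar>\<beta>\<bar> * exp lam \<le> \<alpha>" by (meson abs_ge_zero mult_left_mono order_trans)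
    then show ?thesis by (simp add: exp_minus field_simps)
  qed
  have small: "2 \<le> (1 + \<alpha>) * (1 + \<beta>)" if "-1 < \<beta>" "\<beta> < 0"
  proof -
    \<comment> \<open>the only use of coprimality: it excludes \<open>B = - A\<close>\<close>
    have e: "(1 + \<alpha>) * (1 + \<beta>) = of_int (1 + A + B)"
      using sum prod by (simp add: algebra_simps)
    have "0 < (1 + \<alpha>) * (1 + \<beta>)" using that \<alpha>0 by simp
    then have "1 + A + B > 0" unfolding e by simp
    moreover have "1 + A + B \<noteq> 1"
    proof
      assume "1 + A + B = 1"
      then have "B = - A" by simp
      then have "A = 1" using gcd A0 by simp
      then show False using x33 by (simp add: x_def)
    qed
    ultimately have "2 \<le> 1 + A + B" by linarith
    then show ?thesis unfolding e by linarith
  qed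
  define L' where "L' = nat \<lceil>8 * (1 + ln (real n1 + 1))\<rceil>"
  define L where "L = 8 * L'"
  \<comment> \<open>The fourth root of \<open>n1 + 1\<close>. From
    \<open>ln (n1 + 1) = 4 * ln q \<le> 4 * q\<close>, the squared logarithm is bounded by a
    multiple of \<open>sqrt (n1 + 1)\<close>, so the inequality for \<open>n1\<close> can be solved
    explicitly.\<close>
  define q where "q = sqrt (sqrt (real n1 + 1))"
  have q1: "q \<ge> 1" by (simp add: q_def)
  have q2: "q * q = sqrt (real n1 + 1)" "(q * q) * (q * q) = real n1 + 1" by (simp_all add: q_def)
  have lnq: "0 \<le> ln (real n1 + 1)" "ln (real n1 + 1) \<le> 4 * q"
  proof -
    have "ln (real n1 + 1) = 4 * ln q" by (simp add: q_def ln_sqrt)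
    then show "ln (real n1 + 1) \<le> 4 * q" using ln_le_minus_one[of q] q1 by simp
  qed simp
  define y where "y = 8 * (1 + ln (real n1 + 1))"
  have "y \<ge> 0" using lnq by (simp add: y_def)
  moreover have "L' = nat \<lceil>y\<rceil>" by (simp only: L'_def y_def)
  ultimately have L'b: "y \<le> L'" "L' \<le> y + 1" by linarith+
  then have L64: "64 * (1 + ln (real n1 + 1)) \<le> real L" and Lq: "real L \<le> 328 * q"
    using lnq q1 by (auto simp: L_def y_def)
  define G where "G = (4000 * real L) ^ 2 * (a * lb)"
  have "64 \<le> 64 * (1 + ln (real n1 + 1))" by simp
  then have L1: "real L \<ge> 64" using L64 by (rule order_trans)
  have alb: "1 \<le> a * lb" using mult_mono[of 3 a "1/2" lb] a3 lb by simp
  have G100: "100 \<le> G"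
  proof -
    have "100 * 1 \<le> (4000 * real L) ^ 2 * (a * lb)"
    proof (rule mult_mono)
      have "100 \<le> (4000 * real L)" using L1 by simp
      also have "\<dots> \<le> (4000 * real L) ^ 2" using L1 by (intro self_le_power) auto
      finally show "100 \<le> (4000 * real L) ^ 2" .
    qed (use alb in auto)
    then show ?thesis by (simp add: G_def)
  qed
  have main: "lam * n1 \<le> 100 * G"
  proof (rule exponent_bound[OF \<alpha>31 small b lam(1) lam(2)[unfolded a_def] \<beta>lam G100 _ ord eq])
    fix n m :: nat assume n: "0 < n" "n \<le> n1"
    have "64 * (1 + ln (real n + 1)) \<le> 64 * (1 + ln (real n1 + 1))" using n by simp
    then have "64 * (1 + ln (real n + 1)) \<le> real L" using L64 by (rule order_trans)
    from two_logs[OF a3[unfolded a_def] \<alpha>0 dom b n(1) L_def this]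
    show "exp (- G) \<le> \<bar>real n * ln \<alpha> - real m * ln (of_int b)\<bar>"
      by (simp add: G_def a_def lb_def)
  qed
  have "(real L) ^ 2 \<le> (328 * q) ^ 2" using Lq by (intro power_mono) auto
  then have "16000000 * (real L) ^ 2 * (a * lb) \<le> 16000000 * (328 * q) ^ 2 * (a * lb)"
    using alb by (intro mult_right_mono mult_left_mono) auto
  then have Gq: "G \<le> 1800000000000 * (q * q) * (a * lb)"
  proof -
    assume "16000000 * (real L) ^ 2 * (a * lb) \<le> 16000000 * (328 * q) ^ 2 * (a * lb)"
    also have "\<dots> = 1721344000000 * ((q * q) * (a * lb))" by (simp add: power2_eq_square)
    also have "\<dots> \<le> 1800000000000 * ((q * q) * (a * lb))" using alb q1 by (intro mult_right_mono) auto
    finally show ?thesis by (simp add: G_def power_mult_distrib mult.assoc)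
  qed
  \<comment> \<open>Both \<open>lam\<close> and \<open>G\<close> contain the factor
    \<open>a = ln \<alpha>\<close>; it cancels, which makes the bound independent of
    \<open>A\<close>.\<close>
  have "a * (\<epsilon> * n1) = 4 * (lam * n1)" by (simp add: lam_def)
  also have "\<dots> \<le> 400 * G" using main by simp
  also have "\<dots> \<le> a * (720000000000000 * (q * q) * lb)" using Gq by (simp add: mult_ac)
  finally have n1q: "\<epsilon> * n1 \<le> 720000000000000 * (q * q) * lb" using a3 by simp
  have "n1 \<ge> 1" using ord by simp
  then have "(q * q) * (q * q) \<le> 2 * n1" unfolding q2 by simp
  then have "\<epsilon> * ((q * q) * (q * q)) \<le> \<epsilon> * (2 * n1)" using eps by (intro mult_left_mono) auto
  then have "(q * q) * (\<epsilon> * (q * q)) \<le> (q * q) * (1440000000000000 * lb)" using n1q by (simp add: mult_ac)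
  moreover have "q * q > 0" using q1 by simp
  ultimately have eq: "\<epsilon> * (q * q) \<le> 1440000000000000 * lb" by (simp only: mult_le_cancel_left_pos)
  have "(\<epsilon> * (q * q)) * (\<epsilon> * (q * q)) \<le> (1440000000000000 * lb) * (1440000000000000 * lb)"
    by (rule mult_mono[OF eq eq]) (use eps lb in auto)
  then have "\<epsilon> ^ 2 * (real n1 + 1) \<le> 2073600000000000000000000000000 * lb ^ 2"
    unfolding q2(2)[symmetric] by (simp add: power2_eq_square mult_ac)
  then have up: "real n1 + 1 \<le> 2073600000000000000000000000000 * lb ^ 2 / \<epsilon> ^ 2"
    using eps by (simp add: pos_le_divide_eq mult.commute)
  \<comment> \<open>The quantity in \<open>C1\<close>. As \<open>lb \<ge> 1 / 2\<close>, passing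
    from \<open>lb ^ 2\<close> to \<open>lb ^ 4\<close> costs a factor 4, and
    \<open>W \<ge> 1 / 16\<close> makes the logarithm in \<open>C1\<close> at least 1.\<close>
  define W where "W = lb ^ 4 / \<epsilon> ^ 2"
  have W: "lb ^ 2 / \<epsilon> ^ 2 \<le> 4 * W" "W \<ge> 1 / 16"
  proof -
    have l2: "1 / 4 \<le> lb ^ 2" using power_mono[OF lb, of 2] by (simp add: power2_eq_square)
    have "1 / 4 * (lb ^ 2 / \<epsilon> ^ 2) \<le> lb ^ 2 * (lb ^ 2 / \<epsilon> ^ 2)" using l2 by (intro mult_right_mono) auto
    then show "lb ^ 2 / \<epsilon> ^ 2 \<le> 4 * W" by (simp add: W_def power2_eq_square power4_eq_xxxx)
    have "1 / 4 * (1 / 4) \<le> lb ^ 2 * lb ^ 2" using l2 by (intro mult_mono) auto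
    then have "1 / 16 \<le> lb ^ 4" by (simp add: power2_eq_square power4_eq_xxxx)
    moreover have "\<epsilon> ^ 2 \<le> 1" using eps by (simp add: power_le_one)
    ultimately show "W \<ge> 1 / 16" unfolding W_def using eps by (simp add: pos_le_divide_eq)
  qed
  have "exp 1 \<le> 5.56 * 10 ^ 36 * W" using W(2) exp_le by simp
  then have "1 \<le> ln (5.56 * 10 ^ 36 * W)" using W(2) by (subst ln_ge_iff) auto
  then have "1 \<le> ln (5.56 * 10 ^ 36 * W) ^ 4" by (rule one_le_power)
  then have "4.83 * 10 ^ 32 * W * 1 \<le> 4.83 * 10 ^ 32 * W * ln (5.56 * 10 ^ 36 * W) ^ 4"
    using W(2) by (intro mult_left_mono) auto
  then have "4.83 * 10 ^ 32 * W \<le> C1 \<epsilon> b" by (simp add: C1_def W_def lb_def)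
  then show False using big up W by simp
qed

text \<open>The positive discriminant yields two distinct real roots by the quadratic formula, and a
  rational root would split a linear factor off the irreducible polynomial.\<close>

lemma lucas_poly_roots:
  assumes disc: "A\<^sup>2 - 4 * B > 0" and irr: "irreducible (lucas_poly A B :: rat poly)"
    and roots: "proots (lucas_poly A B :: real poly) = {#\<alpha>, \<beta>#}"
  shows "\<alpha> + \<beta> = of_int A" "\<alpha> * \<beta> = of_int B" "\<alpha> \<noteq> \<beta>" "\<alpha> \<notin> \<rat>"
proof -
  have p0: "(lucas_poly A B :: real poly) \<noteq> 0" by (simp add: lucas_poly_def)
  have root_iff: "z \<in> {\<alpha>, \<beta>} \<longleftrightarrow> z ^ 2 - of_int A * z + of_int B = 0" for z
  proof -
    have "set_mset (proots (lucas_poly A B)) = {z. poly (lucas_poly A B) z = (0::real)}"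
      using p0 by simp
    then have "z \<in> {\<alpha>, \<beta>} \<longleftrightarrow> poly (lucas_poly A B) z = 0" unfolding roots by auto
    then show ?thesis by (simp add: lucas_poly_def power2_eq_square algebra_simps)
  qed
  define D where "D = sqrt (of_int (A\<^sup>2 - 4 * B))"
  have "0 < real_of_int (A\<^sup>2 - 4 * B)" using disc by (simp only: of_int_0_less_iff)
  then have "D > 0" and "D * D = of_int (A\<^sup>2 - 4 * B)" by (simp_all add: D_def del: of_int_diff)
  then have D: "D > 0" "D * D = of_int A * of_int A - 4 * of_int B" by (simp_all add: power2_eq_square)
  define r1 r2 where "r1 = (of_int A + D) / 2" and "r2 = (of_int A - D) / 2"
  have "r1 ^ 2 - of_int A * r1 + of_int B = 0" "r2 ^ 2 - of_int A * r2 + of_int B = 0"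
    using D(2) by (simp_all add: r1_def r2_def power2_eq_square field_simps)
  then have r: "r1 \<in> {\<alpha>, \<beta>}" "r2 \<in> {\<alpha>, \<beta>}" using root_iff by blast+
  have "r1 \<noteq> r2" using D by (simp add: r1_def r2_def)
  then have ab: "(\<alpha> = r1 \<and> \<beta> = r2) \<or> (\<alpha> = r2 \<and> \<beta> = r1)" using r by auto
  have "r1 + r2 = of_int A" "r1 * r2 = of_int B"
    using D(2) by (simp_all add: r1_def r2_def field_simps)
  then show "\<alpha> + \<beta> = of_int A" "\<alpha> * \<beta> = of_int B" "\<alpha> \<noteq> \<beta>"
    using ab \<open>r1 \<noteq> r2\<close> by (auto simp: add.commute mult.commute)
  show "\<alpha> \<notin> \<rat>"
  proof
    assume "\<alpha> \<in> \<rat>"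
    then obtain q where q: "\<alpha> = of_rat q" by (auto elim: Rats_cases)
    have "\<alpha> ^ 2 - of_int A * \<alpha> + of_int B = 0" using root_iff by blast
    then have "real_of_rat (q ^ 2 - of_int A * q + of_int B) = real_of_rat 0"
      unfolding q by (simp add: of_rat_add of_rat_diff of_rat_mult of_rat_power)
    then have "q ^ 2 - of_int A * q + of_int B = 0" by (simp only: of_rat_eq_iff)
    then have "poly (lucas_poly A B) q = 0" by (simp add: lucas_poly_def power2_eq_square algebra_simps)
    then have "[:- q, 1:] dvd lucas_poly A B" by (simp only: poly_eq_0_iff_dvd)
    then obtain s where s: "lucas_poly A B = [:- q, 1:] * s" by (rule dvdE)
    have deg: "degree (lucas_poly A B :: rat poly) = 2" by (simp add: lucas_poly_def)
    have "s \<noteq> 0" using s by (auto simp: lucas_poly_def)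
    then have "degree s = 1" using deg unfolding s by (subst (asm) degree_mult_eq) auto
    have "is_unit [:- q, 1:] \<or> is_unit s" using irreducibleD[OF irr s] .
    then show False using \<open>degree s = 1\<close> \<open>s \<noteq> 0\<close> by (auto simp: is_unit_iff_degree)
  qed
qed

theorem theorem1:
  fixes \<epsilon> \<alpha> \<beta> :: real
    and A B b c :: int
    and n\<^sub>1 n\<^sub>2 n\<^sub>3 m\<^sub>1 m\<^sub>2 m\<^sub>3 :: nat
  assumes "0 < \<epsilon>" and "\<epsilon> < 1"
    and "A > 0"
    and "gcd A B = 1"
    and "A\<^sup>2 - 4 * B > 0"
    and "\<bar>of_int B\<bar> < (of_int A :: real) powr (2 - \<epsilon>)"
    and "irreducible (lucas_poly A B :: rat poly)"
    and "proots (lucas_poly A B) = {#\<alpha>, \<beta>#}"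
    and "c \<ge> 0 \<Longrightarrow> b \<ge> 2"
    and "c < 0 \<Longrightarrow> b \<ge> 3"
    and "lucas_V \<alpha> \<beta> n\<^sub>1 - of_int b ^ m\<^sub>1 = of_int c"
    and "lucas_V \<alpha> \<beta> n\<^sub>2 - of_int b ^ m\<^sub>2 = of_int c"
    and "lucas_V \<alpha> \<beta> n\<^sub>3 - of_int b ^ m\<^sub>3 = of_int c"
    and "n\<^sub>1 > n\<^sub>2" and "n\<^sub>2 > n\<^sub>3" and "of_nat n\<^sub>3 \<ge> N0 \<epsilon>"
  shows "of_nat n\<^sub>1 < C1 \<epsilon> b \<or> of_int A < (32 :: real) powr (1 / \<epsilon>)"
proof (rule disjCI)
  assume "\<not> of_int A < (32 :: real) powr (1 / \<epsilon>)"
  then have A32: "(32 :: real) powr (1 / \<epsilon>) \<le> of_int A" by simp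
  have b: "b \<ge> 2" using assms(9,10) by fastforce
  \<comment> \<open>The threshold exceeds 3/2, so by integrality the smallest index is at least
    2.\<close>
  have "3 / 2 * 1 \<le> 3 / 2 * (1 / \<epsilon>)" using assms(1,2) by (intro mult_left_mono) auto
  then have "3 / 2 \<le> N0 \<epsilon>" by (simp add: N0_def)
  then have n3: "2 \<le> n\<^sub>3" using assms(16) by linarith
  note roots = lucas_poly_roots[OF assms(5,7,8)]
  have irr: "\<beta> \<notin> \<rat>" using roots(1,4) by (metis Rats_diff Rats_of_int add_diff_cancel_right')
  have swap: "\<beta> + \<alpha> = of_int A" "\<beta> * \<alpha> = of_int B" using roots by (simp_all add: add.commute mult.commute)
  have "\<alpha> + \<beta> > 0" using roots(1) assms(3) by simp
  \<comment> \<open>The multiset of roots carries no order. Positive sum and distinctness make one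
    root strictly dominant, and the assumptions are symmetric in the roots.\<close>
  then consider "\<bar>\<beta>\<bar> < \<alpha>" | "\<bar>\<alpha>\<bar> < \<beta>" using roots(3) by linarith
  then show "of_nat n\<^sub>1 < C1 \<epsilon> b"
  proof cases
    case 1
    show ?thesis
      by (rule lucas_bound[OF assms(1-4) roots(1,2,4) 1 assms(6) A32 b assms(15,14) n3
            assms(11-13)[unfolded lucas_V_def]])
  next
    case 2
    show ?thesis
      by (rule lucas_bound[OF assms(1-4) swap irr 2 assms(6) A32 b assms(15,14) n3
            assms(11-13)[unfolded lucas_V_def add.commute[of "\<alpha> ^ _"]]])
  qed
qed

end
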